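(* Let $f(n)=O(n^{1-\varepsilon})$ for a constant $\varepsilon>0$. Suppose there is a polynomial-time algorithm $\mathcal{A}$ that, given matroids $M_0=(N,\mathcal{I}_0)$, $M_1=(N_1,\mathcal{I}_1)$, $M_2=(N_2,\mathcal{I}_2)$ with $N_1,N_2\subseteq N$ (given by oracles) such that some basis of $M_0$ is independent in $M_1$ and $M_2$, returns a basis of $M_0$ that is $f(|N|)$-additively independent in $M_1$ and in $M_2$. Then there is a polynomial-time algorithm that, given such matroids for which some basis of $M_0$ is independent in $M_1$ and $M_2$, finds a basis of $M_0$ that is independent in $M_1$ and $M_2$.
   Context: A set $R$ is $\mu$-additively independent in a matroid $M$ with rank function $r$ if $|R|-r(R)\le\mu$ (here applied to $R\cap N_i$ in $M_i$); equivalently, at most $\mu$ elements can be removed from $R$ to obtain an independent set. A set is independent in $M_i$ if its intersection with $N_i$ lies in $\mathcal{I}_i$. *)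

theory Defs
  imports Complex_Main "HOL-Library.Landau_Symbols" "HOL-Computational_Algebra.Polynomial"
begin

section \<open>Matroids\<close>

locale matroid =
  fixes E :: "'a set" and \<I> :: "'a set set"
  assumes finite_ground: "finite E"
    and indep_subset_ground: "X \<in> \<I> \<Longrightarrow> X \<subseteq> E"
    and empty_indep: "{} \<in> \<I>"
    and indep_subset: "X \<in> \<I> \<Longrightarrow> Y \<subseteq> X \<Longrightarrow> Y \<in> \<I>"
    and augment: "X \<in> \<I> \<Longrightarrow> Y \<in> \<I> \<Longrightarrow> card Y < card X \<Longrightarrow> \<exists>x \<in> X - Y. insert x Y \<in> \<I>"

definition matroid_rank :: "'a set set \<Rightarrow> 'a set \<Rightarrow> nat" where
  "matroid_rank \<I> X = Max (card ` {Y \<in> \<I>. Y \<subseteq> X})"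

definition matroid_basis :: "'a set set \<Rightarrow> 'a set \<Rightarrow> bool" where
  "matroid_basis \<I> B \<longleftrightarrow> B \<in> \<I> \<and> (\<forall>X \<in> \<I>. B \<subseteq> X \<longrightarrow> X = B)"

text \<open>In the next two definitions the set \<open>R\<close> need not be contained in the ground set \<open>E\<close>.\<close>

definition independent_in :: "'a set \<Rightarrow> 'a set set \<Rightarrow> 'a set \<Rightarrow> bool" where
  "independent_in E \<I> R \<longleftrightarrow> R \<inter> E \<in> \<I>"

definition additively_independent_in :: "real \<Rightarrow> 'a set \<Rightarrow> 'a set set \<Rightarrow> 'a set \<Rightarrow> bool" where
  "additively_independent_in \<mu> E \<I> R \<longleftrightarrow>
     real (card (R \<inter> E)) - real (matroid_rank \<I> (R \<inter> E)) \<le> \<mu>"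


section \<open>Deterministic oracle programs with running time\<close>

text \<open>
  The machine model is a structured WHILE language over binary trees (Lisp data) with finitely
  many registers per program, extended by queries to a family of oracles indexed by \<open>'q\<close>.
  An instruction is charged the total size of the trees it handles; only the tests of
  \<open>Cond\<close> and \<open>While\<close>, which look at the root alone, have unit cost.  No value can
  therefore outgrow the input size plus the time spent, and polynomial time coincides with polynomial time on
  oracle Turing machines.
\<close>

datatype sexp = Atom | Dot sexp sexp

primrec sexp_size :: "sexp \<Rightarrow> nat" where
  "sexp_size Atom = 1"
| "sexp_size (Dot x y) = 1 + sexp_size x + sexp_size y"

primrec car :: "sexp \<Rightarrow> sexp" where
  "car Atom = Atom"
| "car (Dot x y) = x"

primrec cdr :: "sexp \<Rightarrow> sexp" where
  "cdr Atom = Atom"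
| "cdr (Dot x y) = y"

primrec sexp_of_list :: "sexp list \<Rightarrow> sexp" where
  "sexp_of_list [] = Atom"
| "sexp_of_list (x # xs) = Dot x (sexp_of_list xs)"

text \<open>Every tree is a list; this is the set of its entries.\<close>

primrec sexp_set :: "sexp \<Rightarrow> sexp set" where
  "sexp_set Atom = {}"
| "sexp_set (Dot x y) = insert x (sexp_set y)"

definition sexp_of_bool :: "bool \<Rightarrow> sexp" where
  "sexp_of_bool b = (if b then Dot Atom Atom else Atom)"

type_synonym reg = nat
type_synonym state = "reg \<Rightarrow> sexp"

datatype 'q com =
    Skip
  | SetAtom reg
  | Copy reg reg
  | MkDot reg reg reg
  | Car reg reg
  | Cdr reg reg
  | Equal reg reg reg
  | Query reg 'q reg
  | Seq "'q com" "'q com"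
  | Cond reg "'q com" "'q com"
  | While reg "'q com"

text \<open>\<open>exec orc c s t s'\<close>: with oracles \<open>orc\<close>, program \<open>c\<close> started in \<open>s\<close> halts in \<open>s'\<close> after time \<open>t\<close>.\<close>

inductive exec :: "('q \<Rightarrow> sexp \<Rightarrow> bool) \<Rightarrow> 'q com \<Rightarrow> state \<Rightarrow> nat \<Rightarrow> state \<Rightarrow> bool"
  for orc :: "'q \<Rightarrow> sexp \<Rightarrow> bool" where
  Skip: "exec orc Skip s 1 s"
| SetAtom: "exec orc (SetAtom r) s 1 (s(r := Atom))"
| Copy: "exec orc (Copy r a) s (1 + sexp_size (s a)) (s(r := s a))"
| MkDot: "exec orc (MkDot r a b) s (1 + sexp_size (s a) + sexp_size (s b)) (s(r := Dot (s a) (s b)))"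
| Car: "exec orc (Car r a) s (1 + sexp_size (s a)) (s(r := car (s a)))"
| Cdr: "exec orc (Cdr r a) s (1 + sexp_size (s a)) (s(r := cdr (s a)))"
| Equal: "exec orc (Equal r a b) s (1 + sexp_size (s a) + sexp_size (s b))
         (s(r := sexp_of_bool (s a = s b)))"
| Query: "exec orc (Query r q a) s (1 + sexp_size (s a)) (s(r := sexp_of_bool (orc q (s a))))"
| Seq: "exec orc c s t s' \<Longrightarrow> exec orc d s' u s'' \<Longrightarrow> exec orc (Seq c d) s (1 + t + u) s''"
| CondTrue: "s r \<noteq> Atom \<Longrightarrow> exec orc c s t s' \<Longrightarrow> exec orc (Cond r c d) s (1 + t) s'"
| CondFalse: "s r = Atom \<Longrightarrow> exec orc d s t s' \<Longrightarrow> exec orc (Cond r c d) s (1 + t) s'"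
| WhileFalse: "s r = Atom \<Longrightarrow> exec orc (While r c) s 1 s"
| WhileTrue: "s r \<noteq> Atom \<Longrightarrow> exec orc c s t s' \<Longrightarrow> exec orc (While r c) s' u s'' \<Longrightarrow>
    exec orc (While r c) s (1 + t + u) s''"

lemma exec_deterministic:
  "exec orc c s t s' \<Longrightarrow> exec orc c s u s'' \<Longrightarrow> u = t \<and> s'' = s'"
proof (induction arbitrary: u s'' rule: exec.induct)
  case (Seq c s t s' d v s1)
  from Seq.prems Seq.IH show ?case by (cases rule: exec.cases) blast+
next
  case (CondTrue s r c t s' d)
  from CondTrue.prems CondTrue.IH CondTrue.hyps show ?case by (cases rule: exec.cases) blast+
next
  case (CondFalse s r d t s' c)
  from CondFalse.prems CondFalse.IH CondFalse.hyps show ?case by (cases rule: exec.cases) blast+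
next
  case (WhileTrue s r c t s' v s1)
  from WhileTrue.prems WhileTrue.IH WhileTrue.hyps show ?case by (cases rule: exec.cases) blast+
qed (erule exec.cases; simp)+

text \<open>The input is placed in register 0, where the output is found as well.\<close>

definition computes ::
  "('q \<Rightarrow> sexp \<Rightarrow> bool) \<Rightarrow> 'q com \<Rightarrow> sexp \<Rightarrow> nat \<Rightarrow> sexp \<Rightarrow> bool" where
  "computes orc c x t y \<longleftrightarrow> (\<exists>s. exec orc c ((\<lambda>_. Atom)(0 := x)) t s \<and> s 0 = y)"


section \<open>Polynomial-time algorithms for matroids given by oracles\<close>

definition feasible_instance ::
  "'a set \<Rightarrow> 'a set set \<Rightarrow> 'a set \<Rightarrow> 'a set set \<Rightarrow> 'a set \<Rightarrow> 'a set set \<Rightarrow> bool" where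
  "feasible_instance N \<I>\<^sub>0 N\<^sub>1 \<I>\<^sub>1 N\<^sub>2 \<I>\<^sub>2 \<longleftrightarrow>
     matroid N \<I>\<^sub>0 \<and> matroid N\<^sub>1 \<I>\<^sub>1 \<and> matroid N\<^sub>2 \<I>\<^sub>2 \<and> N\<^sub>1 \<subseteq> N \<and> N\<^sub>2 \<subseteq> N \<and>
     (\<exists>B. matroid_basis \<I>\<^sub>0 B \<and> independent_in N\<^sub>1 \<I>\<^sub>1 B \<and> independent_in N\<^sub>2 \<I>\<^sub>2 B)"

datatype matroid_index = M0 | M1 | M2

primrec independence_oracle ::
  "sexp set set \<Rightarrow> sexp set set \<Rightarrow> sexp set set \<Rightarrow> matroid_index \<Rightarrow> sexp \<Rightarrow> bool" where
  "independence_oracle \<I>\<^sub>0 \<I>\<^sub>1 \<I>\<^sub>2 M0 x \<longleftrightarrow> sexp_set x \<in> \<I>\<^sub>0"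
| "independence_oracle \<I>\<^sub>0 \<I>\<^sub>1 \<I>\<^sub>2 M1 x \<longleftrightarrow> sexp_set x \<in> \<I>\<^sub>1"
| "independence_oracle \<I>\<^sub>0 \<I>\<^sub>1 \<I>\<^sub>2 M2 x \<longleftrightarrow> sexp_set x \<in> \<I>\<^sub>2"

definition ground_sets_input :: "sexp list \<Rightarrow> sexp list \<Rightarrow> sexp list \<Rightarrow> sexp" where
  "ground_sets_input ns ns\<^sub>1 ns\<^sub>2 = Dot (sexp_of_list ns) (Dot (sexp_of_list ns\<^sub>1) (sexp_of_list ns\<^sub>2))"

text \<open>
  The elements of the ground sets may be arbitrary trees.  The algorithm receives the ground sets
  as lists, in any order, and accesses the families of independent sets only through the oracles.
  Its running time is polynomial in the length of this input.  Nothing is required of it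
  on infeasible instances.  The output is a list of the elements of the set found.
\<close>

definition polytime_finds ::
  "matroid_index com \<Rightarrow>
   (sexp set \<Rightarrow> sexp set set \<Rightarrow> sexp set \<Rightarrow> sexp set set \<Rightarrow> sexp set \<Rightarrow> sexp set set \<Rightarrow> sexp set \<Rightarrow> bool) \<Rightarrow>
   bool" where
  "polytime_finds A goal \<longleftrightarrow>
     (\<exists>p :: nat poly. \<forall>ns ns\<^sub>1 ns\<^sub>2 \<I>\<^sub>0 \<I>\<^sub>1 \<I>\<^sub>2.
        distinct ns \<and> distinct ns\<^sub>1 \<and> distinct ns\<^sub>2 \<and>
        feasible_instance (set ns) \<I>\<^sub>0 (set ns\<^sub>1) \<I>\<^sub>1 (set ns\<^sub>2) \<I>\<^sub>2 \<longrightarrow>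
        (\<exists>t y. computes (independence_oracle \<I>\<^sub>0 \<I>\<^sub>1 \<I>\<^sub>2) A (ground_sets_input ns ns\<^sub>1 ns\<^sub>2) t y \<and>
           t \<le> poly p (sexp_size (ground_sets_input ns ns\<^sub>1 ns\<^sub>2)) \<and>
           goal (set ns) \<I>\<^sub>0 (set ns\<^sub>1) \<I>\<^sub>1 (set ns\<^sub>2) \<I>\<^sub>2 (sexp_set y)))"

end

theory Submission
  imports Defs
begin

text \<open>
  Run the given algorithm on the disjoint union of \<open>k\<close> copies of the instance. A basis of the union
  restricts to a basis in every copy, and every copy in which this restriction is dependent in
  \<open>M\<^sub>i\<close> contributes at least one to the additive violation of \<open>M\<^sub>i\<close>. The violations total at most
  \<open>2 * f (n * k)\<close>, which is less than \<open>k\<close> when \<open>k\<close> is a suitable polynomial in \<open>n\<close>; then some copy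
  carries a basis that is independent in both matroids, and the oracles recognise it.
\<close>

section \<open>Disjoint copies of a matroid\<close>

text \<open>The additive guarantee does not say where the violation sits, so one run on the original
  instance may yield nothing usable. Copies dilute the violation because \<open>f\<close> is
  sublinear: it is bounded by a constant times \<open>(n * k) powr (1 - \<epsilon>)\<close>, which
  polynomially many copies outgrow. The bound holds only from some threshold on and \<open>f\<close>
  need not be monotone, so the number of copies must also push \<open>n * k\<close> past that
  threshold.

  The main obstacle is the machine model. The given algorithm is an arbitrary program that expects
  oracles for the union, while only the original oracles exist. It is therefore run with every query
  replaced by a subroutine that asks the original oracle about each copy. This calls for a calculus
  of polynomial-time functions that is uniform in the oracle and controls the size of intermediate
  values.

  The index set is built from products of a constant list with the list of \<open>N\<close>, so its
  size is a polynomial in \<open>n\<close> although the programs never do arithmetic.\<close>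

definition copies :: "sexp set \<Rightarrow> sexp set \<Rightarrow> sexp set" where
  "copies T X = (\<lambda>(t, x). Dot t x) ` (T \<times> X)"

definition slice :: "sexp \<Rightarrow> sexp set \<Rightarrow> sexp set" where
  "slice t X = {x. Dot t x \<in> X}"

text \<open>Only the tags are constrained here; the ground set is enforced by the slices, since
  members of \<open>\<I>\<close> lie in it. The family thus depends on \<open>T\<close> and
  \<open>\<I>\<close> alone, and membership can be tested without knowing the ground set.\<close>

definition copies_indep :: "sexp set \<Rightarrow> sexp set set \<Rightarrow> sexp set set" where
  "copies_indep T \<I> = {X. X \<subseteq> copies T UNIV \<and> (\<forall>t\<in>T. slice t X \<in> \<I>)}"

lemma Dot_in_copies [simp]: "Dot t x \<in> copies T X \<longleftrightarrow> t \<in> T \<and> x \<in> X"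
  by (auto simp: copies_def)

lemma copiesE:
  assumes "y \<in> copies T X"
  obtains t x where "y = Dot t x" "t \<in> T" "x \<in> X"
  using assms by (auto simp: copies_def)

lemma finite_copies: "finite T \<Longrightarrow> finite X \<Longrightarrow> finite (copies T X)"
  by (simp add: copies_def)

lemma card_copies: "card (copies T X) = card T * card X"
  by (simp add: copies_def card_image inj_on_def card_cartesian_product)

lemma slice_copies: "t \<in> T \<Longrightarrow> slice t (copies T X) = X"
  by (simp add: slice_def)

lemma slice_mono: "X \<subseteq> Y \<Longrightarrow> slice t X \<subseteq> slice t Y"
  by (auto simp: slice_def)

lemma slice_Int: "slice t (X \<inter> Y) = slice t X \<inter> slice t Y"
  by (auto simp: slice_def)

lemma eq_if_slices_eq:
  assumes "X \<subseteq> copies T UNIV" "Y \<subseteq> copies T UNIV" "\<And>t. t \<in> T \<Longrightarrow> slice t X = slice t Y"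
  shows "X = Y"
proof -
  have "z \<in> X \<longleftrightarrow> z \<in> Y" if "z \<in> copies T UNIV" for z
    using that assms(3) by (auto simp: slice_def elim!: copiesE)
  with assms(1,2) show ?thesis by blast
qed

lemma copies_mono: "S \<subseteq> T \<Longrightarrow> X \<subseteq> Y \<Longrightarrow> copies S X \<subseteq> copies T Y"
  by (auto simp: copies_def)

text \<open>Turns a comparison of cardinalities in the union into one inside a single copy, as
  augmentation requires.\<close>

lemma card_eq_sum_slices:
  assumes "finite T" "finite X" "X \<subseteq> copies T UNIV"
  shows "card X = (\<Sum>t\<in>T. card (slice t X))"
proof -
  have fin: "finite (slice t X)" for t
  proof -
    have "inj_on (Dot t) (slice t X)" "Dot t ` slice t X \<subseteq> X"
      by (auto simp: inj_on_def slice_def)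
    then show ?thesis using assms(2) by (meson finite_imageD finite_subset)
  qed
  let ?S = "SIGMA t:T. slice t X"
  have "X = (\<lambda>(t, x). Dot t x) ` ?S"
  proof
    show "X \<subseteq> (\<lambda>(t, x). Dot t x) ` ?S"
    proof
      fix z assume "z \<in> X"
      with assms(3) obtain t x where "z = Dot t x" "t \<in> T" by (auto elim!: copiesE)
      with \<open>z \<in> X\<close> have "(t, x) \<in> ?S" by (simp add: slice_def)
      then show "z \<in> (\<lambda>(t, x). Dot t x) ` ?S" by (rule rev_image_eqI) (simp add: \<open>z = Dot t x\<close>)
    qed
  qed (auto simp: slice_def)
  moreover have "card ((\<lambda>(t, x). Dot t x) ` ?S) = card ?S"
    by (rule card_image) (auto simp: inj_on_def)
  ultimately have "card X = card ?S" by simp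
  then show ?thesis using assms(1) fin by simp
qed

context matroid
begin

lemma matroid_rank_attained:
  obtains Y where "Y \<in> \<I>" "Y \<subseteq> X" "matroid_rank \<I> X = card Y"
proof -
  have "finite \<I>" using indep_subset_ground finite_ground by (auto intro: finite_subset[of _ "Pow E"])
  then have "matroid_rank \<I> X \<in> card ` {Y \<in> \<I>. Y \<subseteq> X}"
    unfolding matroid_rank_def using empty_indep by (intro Max_in) auto
  then show ?thesis using that by auto
qed

end

lemma copies_indep_subset_ground:
  assumes "matroid E \<I>" "X \<in> copies_indep T \<I>"
  shows "X \<subseteq> copies T E"
proof
  fix z assume "z \<in> X"
  with assms(2) obtain t x where z: "z = Dot t x" "t \<in> T"
    by (auto simp: copies_indep_def elim!: copiesE)
  then have "x \<in> slice t X" "slice t X \<in> \<I>"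
    using assms(2) \<open>z \<in> X\<close> by (auto simp: copies_indep_def slice_def)
  then show "z \<in> copies T E"
    using matroid.indep_subset_ground[OF assms(1)] z by auto
qed

lemma matroid_copies:
  assumes "matroid E \<I>" "finite T"
  shows "matroid (copies T E) (copies_indep T \<I>)"
proof -
  interpret matroid E \<I> by fact
  show ?thesis
  proof
    show "finite (copies T E)" using assms(2) finite_ground by (rule finite_copies)
    show "{} \<in> copies_indep T \<I>" using empty_indep by (simp add: copies_indep_def slice_def)
  next
    fix X assume X: "X \<in> copies_indep T \<I>"
    then show "X \<subseteq> copies T E" by (rule copies_indep_subset_ground[OF assms(1)])
    fix Y assume "Y \<subseteq> X"
    then have "slice t Y \<in> \<I>" if "t \<in> T" for t
      using X that by (intro indep_subset[OF _ slice_mono[of Y X]]) (auto simp: copies_indep_def)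
    with X \<open>Y \<subseteq> X\<close> show "Y \<in> copies_indep T \<I>"
      by (auto simp: copies_indep_def)
  next
    fix X Y assume X: "X \<in> copies_indep T \<I>" and Y: "Y \<in> copies_indep T \<I>" and less: "card Y < card X"
    have fin: "finite Z" if "Z \<in> copies_indep T \<I>" for Z
      using copies_indep_subset_ground[OF assms(1) that] finite_copies[OF assms(2) finite_ground]
      by (rule finite_subset)
    have sub: "Z \<subseteq> copies T UNIV" if "Z \<in> copies_indep T \<I>" for Z
      using that by (simp add: copies_indep_def)
    \<comment> \<open>A strict inequality between the sums is strict in some copy; augmenting there
      leaves all other slices alone.\<close>
    have "(\<Sum>t\<in>T. card (slice t Y)) < (\<Sum>t\<in>T. card (slice t X))"
      using less card_eq_sum_slices[OF assms(2) fin sub] X Y by simp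
    then obtain t where t: "t \<in> T" "card (slice t Y) < card (slice t X)"
      by (meson linorder_not_less sum_mono)
    then obtain x where x: "x \<in> slice t X - slice t Y" "insert x (slice t Y) \<in> \<I>"
      using augment[of "slice t X" "slice t Y"] X Y by (auto simp: copies_indep_def)
    have "slice u (insert (Dot t x) Y) = (if u = t then insert x (slice t Y) else slice u Y)" for u
      by (auto simp: slice_def)
    then have "insert (Dot t x) Y \<in> copies_indep T \<I>"
      using x Y t by (auto simp: copies_indep_def)
    then show "\<exists>x\<in>X - Y. insert x Y \<in> copies_indep T \<I>"
      using x by (auto simp: slice_def)
  qed
qed

section \<open>Bases and feasibility of the union\<close>

lemma matroid_basis_indep: "matroid_basis \<I> B \<Longrightarrow> B \<in> \<I>"
  unfolding matroid_basis_def by blast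

lemma matroid_basis_maximal: "matroid_basis \<I> B \<Longrightarrow> X \<in> \<I> \<Longrightarrow> B \<subseteq> X \<Longrightarrow> X = B"
  unfolding matroid_basis_def by blast

lemma matroid_basis_copies:
  assumes "matroid_basis \<I> B"
  shows "matroid_basis (copies_indep T \<I>) (copies T B)"
  unfolding matroid_basis_def
proof (intro conjI ballI impI)
  show "copies T B \<in> copies_indep T \<I>"
    using matroid_basis_indep[OF assms] copies_mono[of T T B UNIV]
    by (simp add: copies_indep_def slice_copies)
  fix X assume X: "X \<in> copies_indep T \<I>" "copies T B \<subseteq> X"
  have "slice t X = slice t (copies T B)" if "t \<in> T" for t
    unfolding slice_copies[OF that]
  proof (rule matroid_basis_maximal[OF assms])
    show "slice t X \<in> \<I>" using X(1) that by (simp add: copies_indep_def)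
    show "B \<subseteq> slice t X" using slice_mono[OF X(2), of t] slice_copies[OF that] by simp
  qed
  moreover have "X \<subseteq> copies T UNIV" using X(1) by (simp add: copies_indep_def)
  ultimately show "X = copies T B"
    by (intro eq_if_slices_eq[of X T] copies_mono) auto
qed

text \<open>Slices can be changed independently of each other: an independent set \<open>X\<close>
  above the slice at \<open>t\<close> can be merged into \<open>B\<close> without affecting the
  other slices, and maximality of \<open>B\<close> then forces \<open>X\<close> to be the
  slice.\<close>

lemma matroid_basis_slice:
  assumes "matroid_basis (copies_indep T \<I>) B" "t \<in> T"
  shows "matroid_basis \<I> (slice t B)"
  unfolding matroid_basis_def
proof (intro conjI ballI impI)
  have B: "B \<in> copies_indep T \<I>" using assms(1) by (rule matroid_basis_indep)
  then show "slice t B \<in> \<I>" using assms(2) by (simp add: copies_indep_def)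
  fix X assume X: "X \<in> \<I>" "slice t B \<subseteq> X"
  have "slice u (B \<union> copies {t} X) = (if u = t then X else slice u B)" for u
    using X(2) by (auto simp: slice_def)
  then have "B \<union> copies {t} X \<in> copies_indep T \<I>"
    using B X(1) assms(2) copies_mono[of "{t}" T X UNIV] by (simp add: copies_indep_def)
  then have "B \<union> copies {t} X = B"
    using assms(1) by (intro matroid_basis_maximal) auto
  then have "copies {t} X \<subseteq> B" by blast
  from slice_mono[OF this, of t] X(2) show "X = slice t B" by (auto simp: slice_copies)
qed

lemma independent_in_copies:
  assumes "independent_in E \<I> B"
  shows "independent_in (copies T E) (copies_indep T \<I>) (copies T B)"
  using assms copies_mono[of T T B UNIV]
  by (auto simp: independent_in_def copies_indep_def slice_Int slice_copies)

text \<open>The given algorithm promises nothing on infeasible instances, so the promise must be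
  carried over: a common solution is repeated in every copy.\<close>

lemma feasible_instance_copies:
  assumes "feasible_instance N \<I>\<^sub>0 N\<^sub>1 \<I>\<^sub>1 N\<^sub>2 \<I>\<^sub>2" "finite T"
  shows "feasible_instance (copies T N) (copies_indep T \<I>\<^sub>0) (copies T N\<^sub>1) (copies_indep T \<I>\<^sub>1)
           (copies T N\<^sub>2) (copies_indep T \<I>\<^sub>2)"
proof -
  obtain B where "matroid_basis \<I>\<^sub>0 B" "independent_in N\<^sub>1 \<I>\<^sub>1 B" "independent_in N\<^sub>2 \<I>\<^sub>2 B"
    using assms(1) by (auto simp: feasible_instance_def)
  then show ?thesis
    using assms unfolding feasible_instance_def
    by (intro conjI exI[of _ "copies T B"] matroid_copies matroid_basis_copies
        independent_in_copies copies_mono) auto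
qed

text \<open>In every copy where \<open>R\<close> is dependent, at least one element has to be removed.\<close>

lemma card_dependent_slices_le:
  assumes "matroid E \<I>" "finite T"
    and "additively_independent_in \<mu> (copies T E) (copies_indep T \<I>) R"
  shows "real (card {t \<in> T. \<not> independent_in E \<I> (slice t R)}) \<le> \<mu>"
proof -
  let ?R = "R \<inter> copies T E"
  let ?D = "{t \<in> T. \<not> independent_in E \<I> (slice t R)}"
  interpret C: matroid "copies T E" "copies_indep T \<I>"
    by (rule matroid_copies[OF assms(1,2)])
  obtain Y where Y: "Y \<in> copies_indep T \<I>" "Y \<subseteq> ?R"
      "matroid_rank (copies_indep T \<I>) ?R = card Y"
    by (rule C.matroid_rank_attained)
  have finR: "finite ?R" using C.finite_ground by simp
  \<comment> \<open>In a bad copy the slice of \<open>Y\<close> is independent and that of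
    \<open>?R\<close> is not, so they differ. The tag of an element tells its copy, hence witnesses
    for different copies are different and \<open>car\<close> maps \<open>?R - Y\<close> onto all of
    \<open>?D\<close>.\<close>
  have "\<exists>z \<in> ?R - Y. car z = t" if "t \<in> ?D" for t
  proof -
    have "slice t ?R = slice t R \<inter> E" using that by (simp add: slice_Int slice_copies)
    with that Y(1) have "slice t Y \<noteq> slice t ?R"
      by (auto simp: independent_in_def copies_indep_def)
    with slice_mono[OF Y(2), of t] obtain x where "x \<in> slice t ?R" "x \<notin> slice t Y" by blast
    then show ?thesis by (intro bexI[of _ "Dot t x"]) (auto simp: slice_def)
  qed
  then have "?D \<subseteq> car ` (?R - Y)" by blast
  then have "card ?D \<le> card (?R - Y)"
    using finR by (meson card_image_le card_mono finite_Diff finite_imageI order_trans)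
  also have "card (?R - Y) = card ?R - card Y"
    using Y(2) finR by (meson card_Diff_subset finite_subset)
  finally have "real (card ?D) \<le> real (card ?R) - real (card Y)"
    using card_mono[OF finR Y(2)] by simp
  with assms(3) Y(3) show ?thesis by (simp add: additively_independent_in_def)
qed

lemma exists_independent_slice:
  assumes "matroid E\<^sub>1 \<I>\<^sub>1" "matroid E\<^sub>2 \<I>\<^sub>2" "finite T"
    and "additively_independent_in \<mu> (copies T E\<^sub>1) (copies_indep T \<I>\<^sub>1) R"
    and "additively_independent_in \<mu> (copies T E\<^sub>2) (copies_indep T \<I>\<^sub>2) R"
    and "2 * \<mu> < real (card T)"
  shows "\<exists>t\<in>T. independent_in E\<^sub>1 \<I>\<^sub>1 (slice t R) \<and> independent_in E\<^sub>2 \<I>\<^sub>2 (slice t R)"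
proof (rule ccontr)
  let ?D1 = "{t \<in> T. \<not> independent_in E\<^sub>1 \<I>\<^sub>1 (slice t R)}"
  let ?D2 = "{t \<in> T. \<not> independent_in E\<^sub>2 \<I>\<^sub>2 (slice t R)}"
  assume "\<not> ?thesis"
  then have "T = ?D1 \<union> ?D2" by blast
  then have "card T \<le> card ?D1 + card ?D2" by (metis card_Un_le)
  moreover have "real (card ?D1) \<le> \<mu>" "real (card ?D2) \<le> \<mu>"
    using card_dependent_slices_le assms by blast+
  ultimately show False using assms(6) by linarith
qed

text \<open>With \<open>k = c * n ^ d\<close> copies one needs \<open>k > 2 * C * (n * k) powr (1 - \<epsilon>)\<close>, that is,
  \<open>k powr \<epsilon> > 2 * C * n powr (1 - \<epsilon>)\<close>, which holds if \<open>d * \<epsilon> \<ge> 1\<close> and \<open>c powr \<epsilon> > 2 * C\<close>.\<close>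

lemma enough_copies:
  fixes f :: "nat \<Rightarrow> real"
  assumes "\<epsilon> > 0" and "f \<in> O(\<lambda>n. real n powr (1 - \<epsilon>))"
  obtains c d :: nat where "\<And>n. 0 < n \<Longrightarrow> 2 * f (c * n ^ d * n) < real (c * n ^ d)" "0 < d"
proof -
  obtain C where C: "C > 0" "eventually (\<lambda>n. norm (f n) \<le> C * norm (real n powr (1 - \<epsilon>))) sequentially"
    using landau_o.bigE[OF assms(2)] by blast
  then obtain n0 where n0: "\<And>n. n \<ge> n0 \<Longrightarrow> f n \<le> C * real n powr (1 - \<epsilon>)"
    unfolding eventually_sequentially by force
  obtain d :: nat where d: "1 / \<epsilon> \<le> real d" using real_arch_simple by blast
  \<comment> \<open>Exported because it makes \<open>c * 0 ^ d\<close> vanish: an empty ground set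
    then yields no copies at all.\<close>
  have "0 < d" using d assms(1) by (cases d) (auto simp: divide_le_0_iff)
  have d1: "1 \<le> real d * \<epsilon>" using d assms(1) by (simp add: field_simps)
  obtain c' :: nat where c': "(2 * C) powr (1 / \<epsilon>) < real c'" using reals_Archimedean2 by blast
  \<comment> \<open>The summand \<open>c'\<close> makes \<open>c powr \<epsilon>\<close> exceed
    \<open>2 * C\<close>, \<open>n0\<close> brings the argument of \<open>f\<close> into the range
    of the asymptotic bound, and \<open>1\<close> keeps the number of copies positive.\<close>
  define c where "c = c' + n0 + 1"
  have "2 * C = ((2 * C) powr (1 / \<epsilon>)) powr \<epsilon>" using C assms(1) by (simp add: powr_powr)
  also have "\<dots> < real c powr \<epsilon>" using c' assms(1) by (intro powr_less_mono2) (auto simp: c_def)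
  finally have c: "2 * C < real c powr \<epsilon>" .
  have "2 * f (c * n ^ d * n) < real (c * n ^ d)" if n: "0 < n" for n
  proof -
    let ?k = "c * n ^ d"
    have k: "0 < ?k" using n by (simp add: c_def)
    have "n0 \<le> c * 1 * 1" by (simp add: c_def)
    also have "\<dots> \<le> ?k * n" using n by (intro mult_le_mono) auto
    finally have "2 * f (?k * n) \<le> 2 * (C * real (?k * n) powr (1 - \<epsilon>))"
      by (intro mult_left_mono n0) auto
    also have "\<dots> = 2 * C * (real n powr (1 - \<epsilon>) * real ?k powr (1 - \<epsilon>))"
      by (simp add: powr_mult)
    also have "\<dots> < real c powr \<epsilon> * (real n powr (1 - \<epsilon>) * real ?k powr (1 - \<epsilon>))"
      using c n k by (intro mult_strict_right_mono) auto
    \<comment> \<open>Since \<open>1 - \<epsilon> \<le> 1 \<le> d * \<epsilon>\<close> and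
      \<open>n \<ge> 1\<close>, the exponent may be raised; the factors of \<open>c\<close> and
      \<open>n\<close> then combine to the power \<open>\<epsilon>\<close> of the number of
      copies.\<close>
    also have "\<dots> \<le> real c powr \<epsilon> * (real n powr (real d * \<epsilon>) * real ?k powr (1 - \<epsilon>))"
      using n d1 assms(1) by (intro mult_left_mono mult_right_mono powr_mono) auto
    also have "\<dots> = real ?k powr \<epsilon> * real ?k powr (1 - \<epsilon>)"
      using n by (simp add: powr_mult powr_powr flip: powr_realpow)
    also have "\<dots> = real ?k" using k by (simp flip: powr_add)
    finally show ?thesis .
  qed
  with \<open>0 < d\<close> show ?thesis using that by blast
qed

section \<open>Polynomial bounds\<close>

text \<open>Lets time bounds be written as plain functions; the polynomial itself is assembled by
  the introduction rules.\<close>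

definition poly_bounded :: "(nat \<Rightarrow> nat) \<Rightarrow> bool" where
  "poly_bounded F \<longleftrightarrow> (\<exists>p. \<forall>n. F n \<le> poly p n)"

text \<open>Natural coefficients cannot be negative. Monotonicity allows a bound on the argument to
  be pushed through a time bound.\<close>

lemma poly_nat_mono: "m \<le> n \<Longrightarrow> poly p m \<le> poly p n" for p :: "nat poly"
  by (induction p) (auto intro!: add_mono mult_mono)

lemma poly_bounded_const: "poly_bounded (\<lambda>_. k)"
  unfolding poly_bounded_def by (rule exI[of _ "[:k:]"]) simp

lemma poly_bounded_id: "poly_bounded (\<lambda>n. n)"
  unfolding poly_bounded_def by (rule exI[of _ "[:0, 1:]"]) simp

lemma poly_bounded_add: "poly_bounded F \<Longrightarrow> poly_bounded G \<Longrightarrow> poly_bounded (\<lambda>n. F n + G n)"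
  unfolding poly_bounded_def by (metis add_mono poly_add)

lemma poly_bounded_mult: "poly_bounded F \<Longrightarrow> poly_bounded G \<Longrightarrow> poly_bounded (\<lambda>n. F n * G n)"
  unfolding poly_bounded_def by (metis mult_le_mono poly_mult)

lemma poly_bounded_poly: "poly_bounded F \<Longrightarrow> poly_bounded (\<lambda>n. poly p (F n))"
  unfolding poly_bounded_def by (metis poly_nat_mono poly_pcompose)

lemmas poly_bounded_intros =
  poly_bounded_const poly_bounded_id poly_bounded_add poly_bounded_mult poly_bounded_poly

section \<open>Trees as lists\<close>

primrec sexp_entries :: "sexp \<Rightarrow> sexp list" where
  "sexp_entries Atom = []"
| "sexp_entries (Dot x y) = x # sexp_entries y"

lemma set_sexp_entries [simp]: "set (sexp_entries x) = sexp_set x"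
  by (induction x) auto

lemma sexp_entries_of_list [simp]: "sexp_entries (sexp_of_list xs) = xs"
  by (induction xs) auto

lemma sexp_set_of_list [simp]: "sexp_set (sexp_of_list xs) = set xs"
  by (induction xs) auto

lemma sexp_of_list_entries [simp]: "sexp_of_list (sexp_entries x) = x"
  by (induction x) auto

lemma sexp_size_pos: "0 < sexp_size x"
  by (cases x) auto

lemma length_sexp_entries_le: "length (sexp_entries x) \<le> sexp_size x"
  by (induction x) auto

lemma sexp_size_entry_le: "e \<in> sexp_set x \<Longrightarrow> sexp_size e \<le> sexp_size x"
  by (induction x) auto

lemma sexp_size_of_bool: "sexp_size (sexp_of_bool b) \<le> 3"
  by (simp add: sexp_of_bool_def)

lemma sexp_size_car: "sexp_size (car x) \<le> sexp_size x"
  by (cases x) auto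

lemma sexp_size_cdr: "sexp_size (cdr x) \<le> sexp_size x"
  by (cases x) auto

lemma sexp_of_bool_eq_Atom [simp]: "sexp_of_bool b = Atom \<longleftrightarrow> \<not> b"
  by (simp add: sexp_of_bool_def)

section \<open>Functions computed in polynomial time\<close>

text \<open>Registers are used like a stack: the input and the output are in register \<open>b\<close>, the
  registers below are preserved, and those above are scratch space of arbitrary initial content.\<close>

definition implements_at ::
  "reg \<Rightarrow> 'q com \<Rightarrow> (('q \<Rightarrow> sexp \<Rightarrow> bool) \<Rightarrow> sexp \<Rightarrow> sexp) \<Rightarrow> nat poly \<Rightarrow> bool" where
  "implements_at b c g p \<longleftrightarrow> (\<forall>orc s. \<exists>t s'. exec orc c s t s' \<and> t \<le> poly p (sexp_size (s b)) \<and>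
     s' b = g orc (s b) \<and> (\<forall>r<b. s' r = s r))"

text \<open>The polynomial is chosen before the base register, so code can be relocated on the stack
  at no cost in the bound. It is also uniform in the oracle, and \<open>g\<close> is total on trees,
  so the closure rules carry no side conditions on inputs.\<close>

definition polytime_fun :: "(('q \<Rightarrow> sexp \<Rightarrow> bool) \<Rightarrow> sexp \<Rightarrow> sexp) \<Rightarrow> bool" where
  "polytime_fun g \<longleftrightarrow> (\<exists>p. \<forall>b. \<exists>c. implements_at b c g p)"

lemma implements_atE:
  assumes "implements_at b c g p"
  obtains t s' where "exec orc c s t s'" "t \<le> poly p (sexp_size (s b))"
    "s' b = g orc (s b)" "\<And>r. r < b \<Longrightarrow> s' r = s r"
  using assms unfolding implements_at_def by metis

lemma polytime_funI:
  assumes "poly_bounded F"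
    and "\<And>b. \<exists>c. \<forall>orc s. \<exists>t s'. exec orc c s t s' \<and> t \<le> F (sexp_size (s b)) \<and>
           s' b = g orc (s b) \<and> (\<forall>r<b. s' r = s r)"
  shows "polytime_fun g"
proof -
  obtain p where p: "\<And>n. F n \<le> poly p n"
    using assms(1) unfolding poly_bounded_def by blast
  show ?thesis
    unfolding polytime_fun_def implements_at_def
    using assms(2) p by (meson order_trans)
qed

text \<open>Every instruction pays for the trees it handles, so whatever it writes is paid for. The
  extra \<open>1\<close> is due to \<open>Query\<close>: on \<open>Atom\<close> it costs 2, but a
  positive answer has size 3.\<close>

lemma exec_size:
  "exec orc c s t s' \<Longrightarrow> s' r = s r \<or> sexp_size (s' r) \<le> t + 1"
proof (induction rule: exec.induct)
  case (Car q a s)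
  show ?case using sexp_size_car[of "s a"] by auto
next
  case (Cdr q a s)
  show ?case using sexp_size_cdr[of "s a"] by auto
next
  case (Equal q a b s)
  show ?case using sexp_size_of_bool[of "s a = s b"] sexp_size_pos[of "s a"] by auto
next
  case (Query r' q a s)
  show ?case using sexp_size_of_bool[of "orc q (s a)"] sexp_size_pos[of "s a"] by auto
qed auto

text \<open>A time bound entails a bound on the output, without which composition could not be
  estimated. The summand \<open>[:1, 1:]\<close> covers both cases of \<open>exec_size\<close>: a
  register never written still has the input size, a written one has at most the time plus
  one.\<close>

lemma polytime_fun_size:
  assumes "polytime_fun g"
  obtains p where "\<And>orc x. sexp_size (g orc x) \<le> poly p (sexp_size x)"
proof -
  obtain p c where c: "implements_at 0 c g p"
    using assms unfolding polytime_fun_def by blast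
  have "sexp_size (g orc x) \<le> poly (p + [:1, 1:]) (sexp_size x)" for orc x
  proof -
    obtain t s' where "exec orc c (\<lambda>_. x) t s'" "t \<le> poly p (sexp_size x)" "s' 0 = g orc x"
      using implements_atE[OF c, of orc "\<lambda>_. x"] by auto
    with exec_size[of orc c "\<lambda>_. x" t s' 0] show ?thesis by auto
  qed
  then show ?thesis by (rule that)
qed

section \<open>Closure under composition, pairing, tests and branching\<close>

lemma polytime_fun_id: "polytime_fun (\<lambda>_ x. x)"
proof (rule polytime_funI[of "\<lambda>_. 1"])
  show "\<exists>c. \<forall>orc s. \<exists>t s'. exec orc c s t s' \<and> t \<le> 1 \<and> s' b = s b \<and> (\<forall>r<b. s' r = s r)" for b
    by (rule exI[of _ Skip]) (blast intro: exec.Skip)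
qed (intro poly_bounded_intros)

lemma polytime_fun_Atom: "polytime_fun (\<lambda>_ _. Atom)"
proof (rule polytime_funI[of "\<lambda>_. 1"])
  show "\<exists>c. \<forall>orc s. \<exists>t s'. exec orc c s t s' \<and> t \<le> 1 \<and> s' b = Atom \<and> (\<forall>r<b. s' r = s r)" for b
    by (rule exI[of _ "SetAtom b"]) (force intro: exec.SetAtom)
qed (intro poly_bounded_intros)

lemma polytime_fun_comp:
  assumes "polytime_fun g" "polytime_fun h"
  shows "polytime_fun (\<lambda>orc x. h orc (g orc x))"
proof -
  obtain p where p: "\<And>b. \<exists>c. implements_at b c g p"
    using assms(1) unfolding polytime_fun_def by blast
  obtain q where q: "\<And>b. \<exists>c. implements_at b c h q"
    using assms(2) unfolding polytime_fun_def by blast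
  obtain z where z: "\<And>orc x. sexp_size (g orc x) \<le> poly z (sexp_size x)"
    using polytime_fun_size[OF assms(1)] by blast
  show ?thesis
  proof (rule polytime_funI[of "\<lambda>n. 1 + poly p n + poly q (poly z n)"])
    fix b
    obtain c where c: "implements_at b c g p" using p by blast
    obtain d where d: "implements_at b d h q" using q by blast
    show "\<exists>c. \<forall>orc s. \<exists>t s'. exec orc c s t s' \<and>
        t \<le> 1 + poly p (sexp_size (s b)) + poly q (poly z (sexp_size (s b))) \<and>
        s' b = h orc (g orc (s b)) \<and> (\<forall>r<b. s' r = s r)"
    proof (intro exI[of _ "Seq c d"] allI)
      fix orc and s :: state
      obtain t s1 where 1: "exec orc c s t s1" "t \<le> poly p (sexp_size (s b))"
          "s1 b = g orc (s b)" "\<And>r. r < b \<Longrightarrow> s1 r = s r"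
        using implements_atE[OF c, where orc = orc and s = s] by blast
      obtain u s2 where 2: "exec orc d s1 u s2" "u \<le> poly q (sexp_size (s1 b))"
          "s2 b = h orc (s1 b)" "\<And>r. r < b \<Longrightarrow> s2 r = s1 r"
        using implements_atE[OF d, where orc = orc and s = s1] by blast
      have "u \<le> poly q (poly z (sexp_size (s b)))"
        using 2(2) 1(3) poly_nat_mono[OF z] by (metis order_trans)
      with 1 2 exec.Seq[OF 1(1) 2(1)]
      show "\<exists>t s'. exec orc (Seq c d) s t s' \<and>
          t \<le> 1 + poly p (sexp_size (s b)) + poly q (poly z (sexp_size (s b))) \<and>
          s' b = h orc (g orc (s b)) \<and> (\<forall>r<b. s' r = s r)"
        by (intro exI[of _ "1 + t + u"] exI[of _ s2]) auto
    qed
  qed (intro poly_bounded_intros)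
qed

lemma polytime_fun_car: "polytime_fun g \<Longrightarrow> polytime_fun (\<lambda>orc x. car (g orc x))"
proof (erule polytime_fun_comp, rule polytime_funI[of "\<lambda>n. 1 + n"])
  show "\<exists>c. \<forall>orc s. \<exists>t s'. exec orc c s t s' \<and> t \<le> 1 + sexp_size (s b) \<and> s' b = car (s b) \<and>
      (\<forall>r<b. s' r = s r)" for b
    by (rule exI[of _ "Car b b"]) (force intro: exec.Car)
qed (intro poly_bounded_intros)

lemma polytime_fun_cdr: "polytime_fun g \<Longrightarrow> polytime_fun (\<lambda>orc x. cdr (g orc x))"
proof (erule polytime_fun_comp, rule polytime_funI[of "\<lambda>n. 1 + n"])
  show "\<exists>c. \<forall>orc s. \<exists>t s'. exec orc c s t s' \<and> t \<le> 1 + sexp_size (s b) \<and> s' b = cdr (s b) \<and>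
      (\<forall>r<b. s' r = s r)" for b
    by (rule exI[of _ "Cdr b b"]) (force intro: exec.Cdr)
qed (intro poly_bounded_intros)

lemma polytime_fun_query:
  "polytime_fun g \<Longrightarrow> polytime_fun (\<lambda>orc x. sexp_of_bool (orc q (g orc x)))"
proof (erule polytime_fun_comp, rule polytime_funI[of "\<lambda>n. 1 + n"])
  show "\<exists>c. \<forall>orc s. \<exists>t s'. exec orc c s t s' \<and> t \<le> 1 + sexp_size (s b) \<and>
      s' b = sexp_of_bool (orc q (s b)) \<and> (\<forall>r<b. s' r = s r)" for b
    by (rule exI[of _ "Query b q b"]) (force intro: exec.Query)
qed (intro poly_bounded_intros)

text \<open>The input has to survive both computations. Each works on its own copy, one register
  higher than the last value to be kept, and code based at a register preserves everything below
  it.\<close>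

lemma polytime_fun_Dot:
  assumes "polytime_fun g" "polytime_fun h"
  shows "polytime_fun (\<lambda>orc x. Dot (g orc x) (h orc x))"
proof -
  obtain p where p: "\<And>b. \<exists>c. implements_at b c g p"
    using assms(1) unfolding polytime_fun_def by blast
  obtain q where q: "\<And>b. \<exists>c. implements_at b c h q"
    using assms(2) unfolding polytime_fun_def by blast
  obtain z where z: "\<And>orc x. sexp_size (g orc x) \<le> poly z (sexp_size x)"
    using polytime_fun_size[OF assms(1)] by blast
  obtain y where y: "\<And>orc x. sexp_size (h orc x) \<le> poly y (sexp_size x)"
    using polytime_fun_size[OF assms(2)] by blast
  let ?F = "\<lambda>n. 7 + 2 * n + poly p n + poly q n + poly z n + poly y n"
  show ?thesis
  proof (rule polytime_funI[of ?F])
    fix b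
    obtain c where c: "implements_at (b + 1) c g p" using p by blast
    obtain d where d: "implements_at (b + 2) d h q" using q by blast
    let ?c = "Seq (Copy (b + 1) b) (Seq c (Seq (Copy (b + 2) b) (Seq d (MkDot b (b + 1) (b + 2)))))"
    show "\<exists>c. \<forall>orc s. \<exists>t s'. exec orc c s t s' \<and> t \<le> ?F (sexp_size (s b)) \<and>
        s' b = Dot (g orc (s b)) (h orc (s b)) \<and> (\<forall>r<b. s' r = s r)"
    proof (intro exI[of _ ?c] allI)
      fix orc and s :: state
      let ?x = "s b"
      define s0 where "s0 = s(b + 1 := ?x)"
      obtain t s1 where 1: "exec orc c s0 t s1" "t \<le> poly p (sexp_size (s0 (b + 1)))"
          "s1 (b + 1) = g orc (s0 (b + 1))" "\<And>r. r < b + 1 \<Longrightarrow> s1 r = s0 r"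
        using implements_atE[OF c, where orc = orc and s = s0] by blast
      define s2 where "s2 = s1(b + 2 := s1 b)"
      obtain u s3 where 2: "exec orc d s2 u s3" "u \<le> poly q (sexp_size (s2 (b + 2)))"
          "s3 (b + 2) = h orc (s2 (b + 2))" "\<And>r. r < b + 2 \<Longrightarrow> s3 r = s2 r"
        using implements_atE[OF d, where orc = orc and s = s2] by blast
      have s1: "s1 b = ?x" "s1 (b + 1) = g orc ?x"
        using 1 by (auto simp: s0_def)
      have s3: "s3 (b + 1) = g orc ?x" "s3 (b + 2) = h orc ?x"
        using 2 s1 by (auto simp: s2_def)
      have e0: "exec orc (Copy (b + 1) b) s (1 + sexp_size ?x) s0"
        unfolding s0_def by (rule exec.Copy)
      have e2: "exec orc (Copy (b + 2) b) s1 (1 + sexp_size (s1 b)) s2"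
        unfolding s2_def by (rule exec.Copy)
      note e = exec.Seq[OF e0 exec.Seq[OF 1(1) exec.Seq[OF e2 exec.Seq[OF 2(1)
        exec.MkDot[of orc b "b + 1" "b + 2" s3]]]]]
      show "\<exists>t s'. exec orc ?c s t s' \<and> t \<le> ?F (sexp_size ?x) \<and>
        s' b = Dot (g orc ?x) (h orc ?x) \<and> (\<forall>r<b. s' r = s r)"
      proof -
        have "t \<le> poly p (sexp_size ?x)" "u \<le> poly q (sexp_size ?x)"
          using 1(2) 2(2) s1 by (auto simp: s0_def s2_def)
        then show ?thesis
          by - (intro exI conjI, rule e,
            use z[of orc ?x] y[of orc ?x] 1(4) 2(4) s1 s3 in \<open>auto simp: s0_def s2_def\<close>)
      qed
    qed
  qed (intro poly_bounded_intros)
qed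

lemma polytime_fun_const: "polytime_fun (\<lambda>_ _. v)"
  by (induction v) (auto intro: polytime_fun_Atom polytime_fun_Dot)

text \<open>The comparison is implemented as a unary function on a pair; pairing and composition
  then handle arbitrary arguments.\<close>

lemma polytime_fun_eq:
  assumes "polytime_fun g" "polytime_fun h"
  shows "polytime_fun (\<lambda>orc x. sexp_of_bool (g orc x = h orc x))"
proof -
  have "polytime_fun (\<lambda>(_ :: 'a \<Rightarrow> sexp \<Rightarrow> bool) x. sexp_of_bool (car x = cdr x))"
  proof (rule polytime_funI[of "\<lambda>n. 5 + 4 * n"])
    fix b
    let ?c = "Seq (Car (b + 1) b) (Seq (Cdr (b + 2) b) (Equal b (b + 1) (b + 2)))"
    show "\<exists>c. \<forall>(orc :: 'a \<Rightarrow> sexp \<Rightarrow> bool) s. \<exists>t s'. exec orc c s t s' \<and>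
        t \<le> 5 + 4 * sexp_size (s b) \<and>
        s' b = sexp_of_bool (car (s b) = cdr (s b)) \<and> (\<forall>r<b. s' r = s r)"
    proof (intro exI[of _ ?c] allI)
      fix orc :: "'a \<Rightarrow> sexp \<Rightarrow> bool" and s :: state
      let ?x = "s b"
      let ?s1 = "s(b + 1 := car ?x)"
      let ?s2 = "?s1(b + 2 := cdr (?s1 b))"
      note e = exec.Seq[OF exec.Car[of orc "b + 1" b s] exec.Seq[OF exec.Cdr[of orc "b + 2" b ?s1]
          exec.Equal[of orc b "b + 1" "b + 2" ?s2]]]
      show "\<exists>t s'. exec orc ?c s t s' \<and> t \<le> 5 + 4 * sexp_size ?x \<and>
          s' b = sexp_of_bool (car ?x = cdr ?x) \<and> (\<forall>r<b. s' r = s r)"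
        by (rule exI, rule exI, rule conjI, rule e)
          (use sexp_size_car[of ?x] sexp_size_cdr[of ?x] in auto)
    qed
  qed (intro poly_bounded_intros)
  from polytime_fun_comp[OF polytime_fun_Dot[OF assms] this] show ?thesis by simp
qed

lemma polytime_fun_if:
  assumes "polytime_fun (\<lambda>orc x. sexp_of_bool (P orc x))" "polytime_fun g" "polytime_fun h"
  shows "polytime_fun (\<lambda>orc x. if P orc x then g orc x else h orc x)"
proof -
  obtain p where p: "\<And>b. \<exists>c. implements_at b c (\<lambda>orc x. sexp_of_bool (P orc x)) p"
    using assms(1) unfolding polytime_fun_def by blast
  obtain q where q: "\<And>b. \<exists>c. implements_at b c g q"
    using assms(2) unfolding polytime_fun_def by blast
  obtain w where w: "\<And>b. \<exists>c. implements_at b c h w"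
    using assms(3) unfolding polytime_fun_def by blast
  let ?F = "\<lambda>n. 4 + n + poly p n + poly q n + poly w n"
  show ?thesis
  proof (rule polytime_funI[of ?F])
    fix b
    obtain c where c: "implements_at (b + 1) c (\<lambda>orc x. sexp_of_bool (P orc x)) p" using p by blast
    obtain d1 where d1: "implements_at b d1 g q" using q by blast
    obtain d2 where d2: "implements_at b d2 h w" using w by blast
    let ?c = "Seq (Copy (b + 1) b) (Seq c (Cond (b + 1) d1 d2))"
    show "\<exists>c. \<forall>orc s. \<exists>t s'. exec orc c s t s' \<and> t \<le> ?F (sexp_size (s b)) \<and>
        s' b = (if P orc (s b) then g orc (s b) else h orc (s b)) \<and> (\<forall>r<b. s' r = s r)"
    proof (intro exI[of _ ?c] allI)
      fix orc and s :: state
      let ?x = "s b"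
      define s0 where "s0 = s(b + 1 := ?x)"
      obtain t s1 where 1: "exec orc c s0 t s1" "t \<le> poly p (sexp_size (s0 (b + 1)))"
          "s1 (b + 1) = sexp_of_bool (P orc (s0 (b + 1)))" "\<And>r. r < b + 1 \<Longrightarrow> s1 r = s0 r"
        using implements_atE[OF c, where orc = orc and s = s0] by blast
      have s1: "s1 b = ?x" "s1 (b + 1) = sexp_of_bool (P orc ?x)"
        using 1 by (auto simp: s0_def)
      have e0: "exec orc (Copy (b + 1) b) s (1 + sexp_size ?x) s0"
        unfolding s0_def by (rule exec.Copy)
      obtain u s2 where 2: "exec orc (Cond (b + 1) d1 d2) s1 (1 + u) s2"
          "u \<le> poly q (sexp_size ?x) + poly w (sexp_size ?x)"
          "s2 b = (if P orc ?x then g orc ?x else h orc ?x)" "\<And>r. r < b \<Longrightarrow> s2 r = s1 r"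
      proof (cases "P orc ?x")
        case True
        obtain u s2 where "exec orc d1 s1 u s2" "u \<le> poly q (sexp_size (s1 b))"
            "s2 b = g orc (s1 b)" "\<And>r. r < b \<Longrightarrow> s2 r = s1 r"
          using implements_atE[OF d1, where orc = orc and s = s1] by blast
        with True s1 that[of u s2] exec.CondTrue[of s1 "b + 1" orc d1 u s2 d2] show thesis by auto
      next
        case False
        obtain u s2 where "exec orc d2 s1 u s2" "u \<le> poly w (sexp_size (s1 b))"
            "s2 b = h orc (s1 b)" "\<And>r. r < b \<Longrightarrow> s2 r = s1 r"
          using implements_atE[OF d2, where orc = orc and s = s1] by blast
        with False s1 that[of u s2] exec.CondFalse[of s1 "b + 1" orc d2 u s2 d1] show thesis by auto
      qed
      note e = exec.Seq[OF e0 exec.Seq[OF 1(1) 2(1)]]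
      show "\<exists>t s'. exec orc ?c s t s' \<and> t \<le> ?F (sexp_size ?x) \<and>
        s' b = (if P orc ?x then g orc ?x else h orc ?x) \<and> (\<forall>r<b. s' r = s r)"
        by (rule exI, rule exI, rule conjI, rule e)
          (use 1(2,4) 2(2,3,4) in \<open>auto simp: s0_def\<close>)
    qed
  qed (intro poly_bounded_intros)
qed

section \<open>Iteration over a list\<close>

lemma fold_size_le:
  assumes "\<And>e acc. e \<in> set es \<Longrightarrow> sexp_size (h e acc) \<le> sexp_size acc + Q"
  shows "sexp_size (fold h es acc) \<le> sexp_size acc + length es * Q"
  using assms
proof (induction es arbitrary: acc)
  case (Cons e es)
  have "sexp_size (fold h es (h e acc)) \<le> sexp_size (h e acc) + length es * Q"
    using Cons by simp
  also have "\<dots> \<le> sexp_size acc + Q + length es * Q" using Cons.prems by simp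
  finally show ?case by simp
qed simp

text \<open>Polynomial-time steps alone do not suffice: a step that doubles the accumulator would
  make it exponentially large. Hence \<open>inc\<close> limits the growth per step additively, by an
  amount that depends on the input and the entry but not on the accumulator. The three arguments of
  \<open>h\<close> are packed as \<open>Dot x (Dot e acc)\<close>.\<close>

lemma polytime_fun_fold:
  assumes l: "polytime_fun l" and a: "polytime_fun a"
    and h: "polytime_fun (\<lambda>orc z. h orc (car z) (car (cdr z)) (cdr (cdr z)))"
    and inc: "\<And>orc x e acc. sexp_size (h orc x e acc) \<le> sexp_size acc + poly q (sexp_size x + sexp_size e)"
  shows "polytime_fun (\<lambda>orc x. fold (h orc x) (sexp_entries (l orc x)) (a orc x))"
proof -
  obtain pl where pl: "\<And>b. \<exists>c. implements_at b c l pl"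
    using l unfolding polytime_fun_def by blast
  obtain pa where pa: "\<And>b. \<exists>c. implements_at b c a pa"
    using a unfolding polytime_fun_def by blast
  obtain ph where ph:
      "\<And>b. \<exists>c. implements_at b c (\<lambda>orc z. h orc (car z) (car (cdr z)) (cdr (cdr z))) ph"
    using h unfolding polytime_fun_def by blast
  obtain zl where zl: "\<And>orc x. sexp_size (l orc x) \<le> poly zl (sexp_size x)"
    using polytime_fun_size[OF l] by blast
  obtain za where za: "\<And>orc x. sexp_size (a orc x) \<le> poly za (sexp_size x)"
    using polytime_fun_size[OF a] by blast
  \<comment> \<open>For inputs of size \<open>n\<close>: \<open>Q\<close> bounds the growth in one
    step, \<open>S\<close> the size of the accumulator at any time, \<open>W\<close> the time of one
    pass through the loop and \<open>F\<close> the total time.\<close>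
  define Q where "Q = (\<lambda>n. poly q (n + poly zl n))"
  define S where "S = (\<lambda>n. poly za n + poly zl n * Q n)"
  define W where "W = (\<lambda>n. 20 + n + 5 * poly zl n + 3 * S n + poly ph (2 + n + poly zl n + S n))"
  define F where "F = (\<lambda>n. 10 + 2 * n + poly pl n + poly pa n + poly zl n * W n + S n)"
  have bounded: "poly_bounded F"
    unfolding F_def W_def S_def Q_def by (intro poly_bounded_intros)
  show ?thesis
  proof (rule polytime_funI[OF bounded])
    fix b
    obtain cl where cl: "implements_at (b + 1) cl l pl" using pl by blast
    obtain ca where ca: "implements_at (b + 2) ca a pa" using pa by blast
    obtain ch where ch: "implements_at (b + 3) ch
        (\<lambda>orc z. h orc (car z) (car (cdr z)) (cdr (cdr z))) ph" using ph by blast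
    let ?body = "Seq (Car (b + 3) (b + 1)) (Seq (MkDot (b + 3) (b + 3) (b + 2))
      (Seq (MkDot (b + 3) b (b + 3)) (Seq ch (Seq (Copy (b + 2) (b + 3)) (Cdr (b + 1) (b + 1))))))"
    let ?c = "Seq (Copy (b + 1) b) (Seq cl (Seq (Copy (b + 2) b) (Seq ca
      (Seq (While (b + 1) ?body) (Copy b (b + 2))))))"
    \<comment> \<open>The last premise is the invariant: the accumulator leaves room for the growth
      still to come. Each pass consumes one entry and at most one \<open>Q n\<close> of that
      room.\<close>
    have loop: "\<exists>t s'. exec orc (While (b + 1) ?body) s t s' \<and>
        t \<le> 1 + length (sexp_entries xs) * W n \<and>
        s' (b + 2) = fold (h orc x) (sexp_entries xs) acc \<and> (\<forall>r\<le>b. s' r = s r)"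
      if "s b = x" "s (b + 1) = xs" "s (b + 2) = acc" "sexp_size x = n"
        "sexp_size xs \<le> poly zl n" "sexp_size acc + length (sexp_entries xs) * Q n \<le> S n"
      for orc s x xs acc n
      using that
    proof (induction xs arbitrary: s acc)
      case Atom
      then have "exec orc (While (b + 1) ?body) s 1 s" by (intro exec.WhileFalse)
      with Atom show ?case by (intro exI[of _ 1] exI[of _ s]) simp
    next
      case (Dot e ys)
      define s1 where "s1 = s(b + 3 := car (s (b + 1)))"
      define s2 where "s2 = s1(b + 3 := Dot (s1 (b + 3)) (s1 (b + 2)))"
      define s3 where "s3 = s2(b + 3 := Dot (s2 b) (s2 (b + 3)))"
      obtain t s4 where 4: "exec orc ch s3 t s4" "t \<le> poly ph (sexp_size (s3 (b + 3)))"
          "s4 (b + 3) = h orc (car (s3 (b + 3))) (car (cdr (s3 (b + 3)))) (cdr (cdr (s3 (b + 3))))"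
          "\<And>r. r < b + 3 \<Longrightarrow> s4 r = s3 r"
        using implements_atE[OF ch, where orc = orc and s = s3] by blast
      define s5 where "s5 = s4(b + 2 := s4 (b + 3))"
      define s6 where "s6 = s5(b + 1 := cdr (s5 (b + 1)))"
      let ?acc = "h orc x e acc"
      have s3: "s3 (b + 3) = Dot x (Dot e acc)"
        using Dot.prems by (simp add: s3_def s2_def s1_def)
      have s4: "s4 (b + 3) = ?acc" using 4(3) s3 by simp
      have s123: "s1 (b + 3) = e" "s1 (b + 2) = acc" "s2 b = x" "s2 (b + 3) = Dot e acc"
        using Dot.prems by (simp_all add: s2_def s1_def)
      have s5: "s5 (b + 1) = Dot e ys"
        using Dot.prems 4(4)[of "b + 1"] by (simp add: s5_def s3_def s2_def s1_def)
      have s6: "s6 b = x" "s6 (b + 1) = ys" "s6 (b + 2) = ?acc"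
        using Dot.prems 4(4)[of b] s4 s5
        by (simp_all add: s6_def s5_def s3_def s2_def s1_def)
      have low: "s6 r = s r" if "r \<le> b" for r
        using that 4(4)[of r] by (simp add: s6_def s5_def s3_def s2_def s1_def)
      have "sexp_size ?acc \<le> sexp_size acc + poly q (sexp_size x + sexp_size e)"
        by (rule inc)
      also have "poly q (sexp_size x + sexp_size e) \<le> Q n"
        unfolding Q_def using Dot.prems by (intro poly_nat_mono) auto
      finally have acc: "sexp_size ?acc \<le> sexp_size acc + Q n" by simp
      have S: "sexp_size acc \<le> S n" "sexp_size ?acc \<le> S n"
          "sexp_size ?acc + length (sexp_entries ys) * Q n \<le> S n"
        using acc Dot.prems(6) by auto
      obtain u s7 where 7: "exec orc (While (b + 1) ?body) s6 u s7"
          "u \<le> 1 + length (sexp_entries ys) * W n"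
          "s7 (b + 2) = fold (h orc x) (sexp_entries ys) ?acc" "\<And>r. r \<le> b \<Longrightarrow> s7 r = s6 r"
        using Dot.IH(2)[of s6 ?acc] s6 Dot.prems S by auto
      have "s (b + 1) \<noteq> Atom" using Dot.prems by simp
      note w = exec.WhileTrue[OF this exec.Seq[OF exec.Car[of orc "b + 3" "b + 1" s, folded s1_def]
          exec.Seq[OF exec.MkDot[of orc "b + 3" "b + 3" "b + 2" s1, folded s2_def]
          exec.Seq[OF exec.MkDot[of orc "b + 3" b "b + 3" s2, folded s3_def]
          exec.Seq[OF 4(1) exec.Seq[OF exec.Copy[of orc "b + 2" "b + 3" s4, folded s5_def]
          exec.Cdr[of orc "b + 1" "b + 1" s5, folded s6_def]]]]]] 7(1)]
      have "t \<le> poly ph (2 + n + poly zl n + S n)"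
        using 4(2) s3 Dot.prems S
        by (intro order_trans[OF 4(2)] poly_nat_mono) auto
      then show ?case
        by - (intro exI conjI, rule w,
          use Dot.prems S s123 s4 s5 7 low in \<open>auto simp: W_def\<close>)
    qed
    show "\<exists>c. \<forall>orc s. \<exists>t s'. exec orc c s t s' \<and> t \<le> F (sexp_size (s b)) \<and>
        s' b = fold (h orc (s b)) (sexp_entries (l orc (s b))) (a orc (s b)) \<and> (\<forall>r<b. s' r = s r)"
    proof (intro exI[of _ ?c] allI)
      fix orc and s :: state
      let ?x = "s b"
      let ?n = "sexp_size ?x"
      define s0 where "s0 = s(b + 1 := ?x)"
      obtain t s1 where 1: "exec orc cl s0 t s1" "t \<le> poly pl (sexp_size (s0 (b + 1)))"
          "s1 (b + 1) = l orc (s0 (b + 1))" "\<And>r. r < b + 1 \<Longrightarrow> s1 r = s0 r"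
        using implements_atE[OF cl, where orc = orc and s = s0] by blast
      define s2 where "s2 = s1(b + 2 := s1 b)"
      obtain u s3 where 2: "exec orc ca s2 u s3" "u \<le> poly pa (sexp_size (s2 (b + 2)))"
          "s3 (b + 2) = a orc (s2 (b + 2))" "\<And>r. r < b + 2 \<Longrightarrow> s3 r = s2 r"
        using implements_atE[OF ca, where orc = orc and s = s2] by blast
      have s1: "s1 b = ?x" "s1 (b + 1) = l orc ?x"
        using 1 by (auto simp: s0_def)
      have s3: "s3 b = ?x" "s3 (b + 1) = l orc ?x" "s3 (b + 2) = a orc ?x"
        using 2 s1 by (auto simp: s2_def)
      have len: "length (sexp_entries (l orc ?x)) \<le> poly zl ?n"
        using length_sexp_entries_le zl by (rule order_trans)
      have S: "sexp_size (a orc ?x) + length (sexp_entries (l orc ?x)) * Q ?n \<le> S ?n"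
        unfolding S_def using za len by (intro add_mono mult_le_mono1)
      obtain v s4 where 4: "exec orc (While (b + 1) ?body) s3 v s4"
          "v \<le> 1 + length (sexp_entries (l orc ?x)) * W ?n"
          "s4 (b + 2) = fold (h orc ?x) (sexp_entries (l orc ?x)) (a orc ?x)"
          "\<And>r. r \<le> b \<Longrightarrow> s4 r = s3 r"
        using loop[OF s3 refl zl S, of orc] by blast
      have "v \<le> 1 + poly zl ?n * W ?n"
        using 4(2) mult_le_mono1[OF len, of "W ?n"] by linarith
      \<comment> \<open>The closing \<open>Copy\<close> is charged the size of the final
        accumulator, so the loop time alone is not the whole cost.\<close>
      moreover have "sexp_size (s4 (b + 2)) \<le> S ?n"
      proof -
        have "sexp_size (h orc ?x e acc) \<le> sexp_size acc + Q ?n"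
          if "e \<in> set (sexp_entries (l orc ?x))" for e acc
        proof -
          have "sexp_size e \<le> poly zl ?n"
            using sexp_size_entry_le[of e "l orc ?x"] that zl[of orc ?x] by simp
          then have "poly q (?n + sexp_size e) \<le> Q ?n"
            unfolding Q_def by (intro poly_nat_mono) simp
          then show ?thesis using inc[of orc ?x e acc] by linarith
        qed
        then have "sexp_size (s4 (b + 2)) \<le>
            sexp_size (a orc ?x) + length (sexp_entries (l orc ?x)) * Q ?n"
          unfolding 4(3) by (rule fold_size_le)
        with S show ?thesis by (rule order_trans[rotated])
      qed
      ultimately have F: "1 + (1 + sexp_size (s b)) + (1 + t + (1 + (1 + sexp_size (s1 b)) + (1 + u +
          (1 + v + (1 + sexp_size (s4 (b + 2))))))) \<le> F ?n"
        using 1(2) 2(2) s1 by (simp add: s0_def s2_def F_def)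
      note e = exec.Seq[OF exec.Copy[of orc "b + 1" b s, folded s0_def] exec.Seq[OF 1(1)
          exec.Seq[OF exec.Copy[of orc "b + 2" b s1, folded s2_def] exec.Seq[OF 2(1)
          exec.Seq[OF 4(1) exec.Copy[of orc b "b + 2" s4]]]]]]
      show "\<exists>t s'. exec orc ?c s t s' \<and> t \<le> F ?n \<and>
        s' b = fold (h orc ?x) (sexp_entries (l orc ?x)) (a orc ?x) \<and> (\<forall>r<b. s' r = s r)"
        by (intro exI conjI, rule e, rule F)
          (use 1(4) 2(4) 4(3,4) in \<open>auto simp: s0_def s2_def\<close>)
    qed
  qed
qed

section \<open>Logical connectives, bounded quantifiers and list operations\<close>

lemma polytime_fun_conj:
  assumes "polytime_fun (\<lambda>orc x. sexp_of_bool (P orc x))" "polytime_fun (\<lambda>orc x. sexp_of_bool (Q orc x))"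
  shows "polytime_fun (\<lambda>orc x. sexp_of_bool (P orc x \<and> Q orc x))"
proof -
  have "polytime_fun (\<lambda>orc x. if P orc x then sexp_of_bool (Q orc x) else Atom)"
    by (intro polytime_fun_if polytime_fun_Atom assms)
  also have "(\<lambda>orc x. if P orc x then sexp_of_bool (Q orc x) else Atom) =
      (\<lambda>orc x. sexp_of_bool (P orc x \<and> Q orc x))"
    by (auto simp: fun_eq_iff sexp_of_bool_def)
  finally show ?thesis .
qed

lemma polytime_fun_not:
  assumes "polytime_fun (\<lambda>orc x. sexp_of_bool (P orc x))"
  shows "polytime_fun (\<lambda>orc x. sexp_of_bool (\<not> P orc x))"
proof -
  have "polytime_fun (\<lambda>orc x. if P orc x then Atom else sexp_of_bool True)"
    by (intro polytime_fun_if polytime_fun_const assms)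
  also have "(\<lambda>orc x. if P orc x then Atom else sexp_of_bool True) =
      (\<lambda>orc x. sexp_of_bool (\<not> P orc x))"
    by (auto simp: fun_eq_iff sexp_of_bool_def)
  finally show ?thesis .
qed

text \<open>The accumulator is a flag: it starts as true, a violating entry resets it to
  \<open>Atom\<close>, and nothing sets it again. It never grows, so the growth bound is
  \<open>0\<close>.\<close>

lemma polytime_fun_ball:
  assumes "polytime_fun l" "polytime_fun (\<lambda>orc z. sexp_of_bool (P orc (car z) (cdr z)))"
  shows "polytime_fun (\<lambda>orc x. sexp_of_bool (\<forall>e\<in>sexp_set (l orc x). P orc x e))"
proof -
  let ?h = "\<lambda>orc x e acc. if P orc x e then acc else Atom"
  have eq: "fold (?h orc x) es acc = (if \<forall>e\<in>set es. P orc x e then acc else Atom)" for orc x es acc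
    by (induction es arbitrary: acc) auto
  have P: "polytime_fun (\<lambda>orc z. sexp_of_bool (P orc (car z) (car (cdr z))))"
    using polytime_fun_comp[OF polytime_fun_Dot[OF
          polytime_fun_car[OF polytime_fun_id] polytime_fun_car[OF polytime_fun_cdr[OF polytime_fun_id]]]
        assms(2)] by simp
  have "polytime_fun (\<lambda>orc x. fold (?h orc x) (sexp_entries (l orc x)) (sexp_of_bool True))"
  proof (rule polytime_fun_fold[where q = 0])
    show "polytime_fun (\<lambda>orc z. if P orc (car z) (car (cdr z)) then cdr (cdr z) else Atom)"
      by (intro polytime_fun_if polytime_fun_cdr polytime_fun_id polytime_fun_Atom P)
    show "sexp_size (?h orc x e acc) \<le> sexp_size acc + poly 0 (sexp_size x + sexp_size e)"
      for orc x e acc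
      using sexp_size_pos[of acc] by simp
  qed (intro assms polytime_fun_const)+
  also have "(\<lambda>orc x. fold (?h orc x) (sexp_entries (l orc x)) (sexp_of_bool True)) =
      (\<lambda>orc x. sexp_of_bool (\<forall>e\<in>sexp_set (l orc x). P orc x e))"
    unfolding eq by (auto simp: fun_eq_iff sexp_of_bool_def)
  finally show ?thesis .
qed

lemma polytime_fun_member:
  assumes "polytime_fun g" "polytime_fun l"
  shows "polytime_fun (\<lambda>orc x. sexp_of_bool (g orc x \<in> sexp_set (l orc x)))"
proof -
  have "polytime_fun (\<lambda>orc x. sexp_of_bool (\<not> (\<forall>e\<in>sexp_set (l orc x). \<not> e = g orc x)))"
    by (intro polytime_fun_not polytime_fun_ball assms polytime_fun_eq
        polytime_fun_cdr polytime_fun_id polytime_fun_comp[OF polytime_fun_car[OF polytime_fun_id] assms(1)])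
  then show ?thesis by (simp add: Ball_def)
qed

text \<open>Filter and map in a single fold. The order is reversed, which is harmless because
  oracles and outputs are read through \<open>sexp_set\<close>.\<close>

definition sexp_collect :: "(sexp \<Rightarrow> bool) \<Rightarrow> (sexp \<Rightarrow> sexp) \<Rightarrow> sexp \<Rightarrow> sexp" where
  "sexp_collect P g l = fold (\<lambda>e acc. if P e then Dot (g e) acc else acc) (sexp_entries l) Atom"

lemma sexp_set_collect [simp]: "sexp_set (sexp_collect P g l) = g ` {e \<in> sexp_set l. P e}"
proof -
  have "sexp_set (fold (\<lambda>e acc. if P e then Dot (g e) acc else acc) es acc) =
      g ` {e \<in> set es. P e} \<union> sexp_set acc" for es acc
    by (induction es arbitrary: acc) auto
  from this[of "sexp_entries l"] show ?thesis by (simp add: sexp_collect_def)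
qed

lemma polytime_fun_collect:
  assumes "polytime_fun l" "polytime_fun (\<lambda>orc z. sexp_of_bool (P orc (car z) (cdr z)))"
    and g: "polytime_fun (\<lambda>orc z. g orc (car z) (cdr z))"
  shows "polytime_fun (\<lambda>orc x. sexp_collect (P orc x) (g orc x) (l orc x))"
proof -
  let ?h = "\<lambda>orc x e acc. if P orc x e then Dot (g orc x e) acc else acc"
  note arg = polytime_fun_Dot[OF
          polytime_fun_car[OF polytime_fun_id] polytime_fun_car[OF polytime_fun_cdr[OF polytime_fun_id]]]
  have P: "polytime_fun (\<lambda>orc z. sexp_of_bool (P orc (car z) (car (cdr z))))"
    using polytime_fun_comp[OF arg assms(2)] by simp
  have g': "polytime_fun (\<lambda>orc z. g orc (car z) (car (cdr z)))"
    using polytime_fun_comp[OF arg g] by simp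
  obtain p where p: "\<And>orc z. sexp_size (g orc (car z) (cdr z)) \<le> poly p (sexp_size z)"
    using polytime_fun_size[OF g] by blast
  show ?thesis
    unfolding sexp_collect_def
  \<comment> \<open>One new node plus the value of \<open>g\<close> on \<open>Dot x e\<close>; that
    pair has size one more than its components, hence the substitution of
    \<open>[:1, 1:]\<close>.\<close>
  proof (rule polytime_fun_fold[where q = "[:1:] + p \<circ>\<^sub>p [:1, 1:]"])
    show "polytime_fun (\<lambda>orc z. if P orc (car z) (car (cdr z))
        then Dot (g orc (car z) (car (cdr z))) (cdr (cdr z)) else cdr (cdr z))"
      by (intro polytime_fun_if polytime_fun_Dot polytime_fun_cdr polytime_fun_id P g')
    show "sexp_size (?h orc x e acc) \<le>
        sexp_size acc + poly ([:1:] + p \<circ>\<^sub>p [:1, 1:]) (sexp_size x + sexp_size e)" for orc x e acc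
      using p[of orc "Dot x e"] by (simp add: poly_pcompose)
  qed (intro assms polytime_fun_Atom)+
qed

text \<open>The entry \<open>Dot t x\<close> is the copy of \<open>x\<close> tagged \<open>t\<close>.\<close>

definition sexp_prod :: "sexp \<Rightarrow> sexp \<Rightarrow> sexp" where
  "sexp_prod ts l =
     fold (\<lambda>t. fold (\<lambda>e. Dot (Dot t e)) (sexp_entries l)) (sexp_entries ts) Atom"

text \<open>The list itself is determined, not only its set, because ground sets have to be passed
  on as lists without repetition.\<close>

lemma sexp_entries_prod:
  "sexp_entries (sexp_prod ts l) =
     rev (concat (map (\<lambda>t. map (Dot t) (sexp_entries l)) (sexp_entries ts)))"
proof -
  have 1: "sexp_entries (fold (\<lambda>e. Dot (Dot t e)) es acc) = rev (map (Dot t) es) @ sexp_entries acc"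
    for t es acc
    by (induction es arbitrary: acc) auto
  have "sexp_entries (fold (\<lambda>t. fold (\<lambda>e. Dot (Dot t e)) (sexp_entries l)) us acc) =
      rev (concat (map (\<lambda>t. map (Dot t) (sexp_entries l)) us)) @ sexp_entries acc" for us acc
    by (induction us arbitrary: acc) (auto simp: 1)
  from this[of "sexp_entries ts" Atom] show ?thesis by (simp add: sexp_prod_def)
qed

lemma sexp_set_prod [simp]:
  "sexp_set (sexp_prod ts l) = copies (sexp_set ts) (sexp_set l)"
  unfolding set_sexp_entries[symmetric] sexp_entries_prod by (auto simp: copies_def)

lemma distinct_sexp_prod:
  assumes "distinct (sexp_entries ts)" "distinct (sexp_entries l)"
  shows "distinct (sexp_entries (sexp_prod ts l))"
proof -
  have "distinct (concat (map (\<lambda>t. map (Dot t) (sexp_entries l)) us))" if "distinct us" for us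
    using that by (induction us) (auto simp: distinct_map inj_on_def assms(2))
  then show ?thesis by (simp add: sexp_entries_prod assms(1))
qed

lemma polytime_fun_prod:
  assumes "polytime_fun ts" "polytime_fun l"
  shows "polytime_fun (\<lambda>orc x. sexp_prod (ts orc x) (l orc x))"
proof -
  let ?g = "\<lambda>orc x t. fold (\<lambda>e. Dot (Dot t e)) (sexp_entries (l orc x))"
  obtain p where p: "\<And>orc x. sexp_size (l orc x) \<le> poly p (sexp_size x)"
    using polytime_fun_size[OF assms(2)] by blast
  \<comment> \<open>The body of the outer fold is itself a fold whose input is the packed triple, so
    the tag becomes \<open>car (cdr z)\<close> and the accumulator is the initial value.\<close>
  have inner: "polytime_fun (\<lambda>orc z. ?g orc (car z) (car (cdr z)) (cdr (cdr z)))"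
  proof (rule polytime_fun_fold[where q = "[:2, 1:]" and h = "\<lambda>orc z e. Dot (Dot (car (cdr z)) e)"])
    show "polytime_fun (\<lambda>orc z. Dot (Dot (car (cdr (car z))) (car (cdr z))) (cdr (cdr z)))"
      by (intro polytime_fun_Dot polytime_fun_car polytime_fun_cdr polytime_fun_id)
    show "sexp_size (Dot (Dot (car (cdr z)) e) acc) \<le>
        sexp_size acc + poly [:2, 1:] (sexp_size z + sexp_size e)" for z e acc
      using sexp_size_car[of "cdr z"] sexp_size_cdr[of z] by simp
    show "polytime_fun (\<lambda>orc z. l orc (car z))"
      by (intro polytime_fun_comp[OF _ assms(2)] polytime_fun_car polytime_fun_id)
  qed (intro polytime_fun_cdr polytime_fun_id)
  show ?thesis
    unfolding sexp_prod_def
  \<comment> \<open>For one tag, at most \<open>p\<close> entries are added, each costing two nodes,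
    the tag and an element of the list, whose size is again at most \<open>p\<close>.\<close>
  proof (rule polytime_fun_fold[where q = "p * ([:2, 1:] + p)"])
    show "polytime_fun (\<lambda>orc z. ?g orc (car z) (car (cdr z)) (cdr (cdr z)))"
      by (rule inner)
    show "sexp_size (?g orc x t acc) \<le>
        sexp_size acc + poly (p * ([:2, 1:] + p)) (sexp_size x + sexp_size t)" for orc x t acc
    proof -
      let ?N = "sexp_size x + sexp_size t"
      have l: "sexp_size (l orc x) \<le> poly p ?N"
        using p[of orc x] poly_nat_mono[of "sexp_size x" ?N p] by simp
      have "sexp_size (?g orc x t acc) \<le>
          sexp_size acc + length (sexp_entries (l orc x)) * (2 + sexp_size t + sexp_size (l orc x))"
        by (rule fold_size_le) (auto dest: sexp_size_entry_le)
      also have "\<dots> \<le> sexp_size acc + poly p ?N * (2 + ?N + poly p ?N)"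
        using l length_sexp_entries_le[of "l orc x"]
        by (intro add_mono mult_mono) auto
      finally show ?thesis by (simp add: algebra_simps)
    qed
  qed (intro assms polytime_fun_Atom)+
qed

text \<open>Search through a list. A hit overwrites the accumulator by a value whose size does not
  depend on it, so the additive growth condition holds.\<close>

lemma polytime_fun_select:
  assumes "polytime_fun l" "polytime_fun (\<lambda>orc z. sexp_of_bool (P orc (car z) (cdr z)))"
    and g: "polytime_fun (\<lambda>orc z. g orc (car z) (cdr z))"
  shows "polytime_fun (\<lambda>orc x. fold (\<lambda>e acc. if P orc x e then g orc x e else acc)
           (sexp_entries (l orc x)) Atom)"
proof -
  let ?h = "\<lambda>orc x e acc. if P orc x e then g orc x e else acc"
  note arg = polytime_fun_Dot[OF
          polytime_fun_car[OF polytime_fun_id] polytime_fun_car[OF polytime_fun_cdr[OF polytime_fun_id]]]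
  have P: "polytime_fun (\<lambda>orc z. sexp_of_bool (P orc (car z) (car (cdr z))))"
    using polytime_fun_comp[OF arg assms(2)] by simp
  have g': "polytime_fun (\<lambda>orc z. g orc (car z) (car (cdr z)))"
    using polytime_fun_comp[OF arg g] by simp
  obtain p where p: "\<And>orc z. sexp_size (g orc (car z) (cdr z)) \<le> poly p (sexp_size z)"
    using polytime_fun_size[OF g] by blast
  show ?thesis
  proof (rule polytime_fun_fold[where q = "p \<circ>\<^sub>p [:1, 1:]"])
    show "polytime_fun (\<lambda>orc z. if P orc (car z) (car (cdr z))
        then g orc (car z) (car (cdr z)) else cdr (cdr z))"
      by (intro polytime_fun_if polytime_fun_cdr polytime_fun_id P g')
    show "sexp_size (?h orc x e acc) \<le>
        sexp_size acc + poly (p \<circ>\<^sub>p [:1, 1:]) (sexp_size x + sexp_size e)" for orc x e acc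
      using p[of orc "Dot x e"] by (simp add: poly_pcompose)
  qed (intro assms polytime_fun_Atom)+
qed

text \<open>The surviving value is that of the last hit. Which hit it is stays hidden, so later
  arguments cannot depend on the order of the list.\<close>

lemma fold_select:
  assumes "\<exists>e\<in>set es. P e"
  obtains e where "e \<in> set es" "P e"
    "fold (\<lambda>e acc. if P e then g e else acc) es a = g e"
  using assms
proof (induction es arbitrary: a thesis)
  case (Cons e es)
  show ?case
  proof (cases "\<exists>e\<in>set es. P e")
    case True
    show ?thesis
    proof (rule Cons.IH[OF _ True])
      show thesis if "x \<in> set es" "P x"
          "fold (\<lambda>e acc. if P e then g e else acc) es (if P e then g e else a) = g x" for x
        using that by (intro Cons.prems(1)[of x]) auto
    qed
  next
    case False
    then have "fold (\<lambda>e acc. if P e then g e else acc) es b = b" for b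
      by (induction es) auto
    moreover have "P e" using False Cons.prems(2) by auto
    ultimately show ?thesis by (intro Cons.prems(1)[of e]) auto
  qed
qed simp

section \<open>Replacing oracle queries by subroutines\<close>

text \<open>An exclusive bound on the registers mentioned: all registers from this number on are
  free for the context and the subroutines.\<close>

primrec reg_bound :: "'q com \<Rightarrow> nat" where
  "reg_bound Skip = 0"
| "reg_bound (SetAtom r) = Suc r"
| "reg_bound (Copy r a) = Suc (max r a)"
| "reg_bound (MkDot r a b) = Suc (max r (max a b))"
| "reg_bound (Car r a) = Suc (max r a)"
| "reg_bound (Cdr r a) = Suc (max r a)"
| "reg_bound (Equal r a b) = Suc (max r (max a b))"
| "reg_bound (Query r q a) = Suc (max r a)"
| "reg_bound (Seq c d) = max (reg_bound c) (reg_bound d)"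
| "reg_bound (Cond r c d) = max (Suc r) (max (reg_bound c) (reg_bound d))"
| "reg_bound (While r c) = max (Suc r) (reg_bound c)"

text \<open>Register \<open>m\<close> holds a fixed context, which is paired with the argument of the query.\<close>

primrec simulate :: "reg \<Rightarrow> ('q \<Rightarrow> 'p com) \<Rightarrow> 'q com \<Rightarrow> 'p com" where
  "simulate m sub Skip = Skip"
| "simulate m sub (SetAtom r) = SetAtom r"
| "simulate m sub (Copy r a) = Copy r a"
| "simulate m sub (MkDot r a b) = MkDot r a b"
| "simulate m sub (Car r a) = Car r a"
| "simulate m sub (Cdr r a) = Cdr r a"
| "simulate m sub (Equal r a b) = Equal r a b"
| "simulate m sub (Query r q a) = Seq (MkDot (m + 1) m a) (Seq (sub q) (Copy r (m + 1)))"
| "simulate m sub (Seq c d) = Seq (simulate m sub c) (simulate m sub d)"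
| "simulate m sub (Cond r c d) = Cond r (simulate m sub c) (simulate m sub d)"
| "simulate m sub (While r c) = While r (simulate m sub c)"

text \<open>The simulation keeps the registers below \<open>m\<close> in step with the original run
  and the context in \<open>m\<close>. One factor \<open>K\<close> must serve the whole induction,
  so it is fixed in terms of a total time \<open>t0\<close>, while \<open>t\<close> ranges over the
  times of subprograms.\<close>

lemma exec_simulate:
  assumes "exec orc' c s t s'"
    and "reg_bound c \<le> m"
    and sub: "\<And>q. implements_at (m + 1) (sub q) (g q) p"
    and g: "\<And>q x. g q orc (Dot ctx x) = sexp_of_bool (orc' q x)"
    and K: "9 + sexp_size ctx + poly p (1 + sexp_size ctx + t0) \<le> K" and "t \<le> t0"
    and "\<forall>r<m. u r = s r" "u m = ctx"
  shows "\<exists>t' u'. exec orc (simulate m sub c) u t' u' \<and> t' \<le> K * t \<and> (\<forall>r<m. u' r = s' r) \<and> u' m = ctx"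
proof -
  have K1: "k \<le> K * k" for k using K by simp
  show ?thesis
    using assms(1,2) \<open>t \<le> t0\<close> assms(7,8)
  proof (induction arbitrary: u rule: exec.induct)
    case (Skip s)
    then show ?case using exec.Skip[of orc u] K1[of 1] by auto
  next
    case (SetAtom r s)
    then show ?case
      by - (intro exI conjI, unfold simulate.simps, rule exec.SetAtom, use SetAtom K1[of 1] in auto)
  next
    case (Copy r a s)
    then show ?case
      by - (intro exI conjI, unfold simulate.simps, rule exec.Copy, use Copy K1[of "1 + sexp_size (s a)"] in auto)
  next
    case (MkDot r a b s)
    then show ?case
      by - (intro exI conjI, unfold simulate.simps, rule exec.MkDot, use MkDot K1[of "1 + sexp_size (s a) + sexp_size (s b)"] in auto)
  next
    case (Car r a s)
    then show ?case
      by - (intro exI conjI, unfold simulate.simps, rule exec.Car, use Car K1[of "1 + sexp_size (s a)"] in auto)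
  next
    case (Cdr r a s)
    then show ?case
      by - (intro exI conjI, unfold simulate.simps, rule exec.Cdr, use Cdr K1[of "1 + sexp_size (s a)"] in auto)
  next
    case (Equal r a b s)
    then show ?case
      by - (intro exI conjI, unfold simulate.simps, rule exec.Equal, use Equal K1[of "1 + sexp_size (s a) + sexp_size (s b)"] in auto)
  next
    case (Query r q a s)
    define u1 where "u1 = u(m + 1 := Dot (u m) (u a))"
    obtain v u2 where 2: "exec orc (sub q) u1 v u2" "v \<le> poly p (sexp_size (u1 (m + 1)))"
        "u2 (m + 1) = g q orc (u1 (m + 1))" "\<And>r. r < m + 1 \<Longrightarrow> u2 r = u1 r"
      using implements_atE[OF sub, where orc = orc and s = u1] by blast
    have a: "u a = s a" "a < m" "r < m" using Query by auto
    have u1: "u1 (m + 1) = Dot ctx (s a)" using Query a by (simp add: u1_def)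
    have u2: "u2 (m + 1) = sexp_of_bool (orc' q (s a))" using 2(3) u1 g by simp
    note e = exec.Seq[OF exec.MkDot[of orc "m + 1" m a u, folded u1_def] exec.Seq[OF 2(1)
        exec.Copy[of orc r "m + 1" u2]]]
    \<comment> \<open>The original query is charged the size of its argument, which is therefore at
      most \<open>t0\<close>.\<close>
    have "v \<le> poly p (1 + sexp_size ctx + t0)"
      using Query u1 by (intro order_trans[OF 2(2)] poly_nat_mono) simp
    then have "1 + (1 + sexp_size (u m) + sexp_size (u a)) + (1 + v + (1 + sexp_size (u2 (m + 1))))
        \<le> sexp_size (s a) + K"
      using K sexp_size_of_bool[of "orc' q (s a)"] Query a u2 by simp
    \<comment> \<open>The subroutine and the fixed overhead are paid by the unit cost of the query,
      the copying of the argument by the rest of its charge.\<close>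
    also have "\<dots> \<le> K * (1 + sexp_size (s a))"
      using K1[of "sexp_size (s a)"] by simp
    finally show ?case
      by - (intro exI conjI, unfold simulate.simps, rule e,
        use u2 2(4) Query in \<open>auto simp: u1_def\<close>)
  next
    case (Seq c s t s' d w s'')
    obtain t1 u1 where 1: "exec orc (simulate m sub c) u t1 u1" "t1 \<le> K * t"
        "\<forall>r<m. u1 r = s' r" "u1 m = ctx"
      using Seq.IH(1)[of u] Seq.prems by auto
    obtain t2 u2 where 2: "exec orc (simulate m sub d) u1 t2 u2" "t2 \<le> K * w"
        "\<forall>r<m. u2 r = s'' r" "u2 m = ctx"
      using Seq.IH(2)[of u1] Seq.prems 1 by auto
    show ?case
      by (intro exI conjI, unfold simulate.simps, rule exec.Seq[OF 1(1) 2(1)])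
        (use 1 2 K1[of 1] in \<open>auto simp: algebra_simps\<close>)
  next
    case (CondTrue s r c t s' d)
    obtain t1 u1 where 1: "exec orc (simulate m sub c) u t1 u1" "t1 \<le> K * t"
        "\<forall>r<m. u1 r = s' r" "u1 m = ctx"
      using CondTrue.IH[of u] CondTrue.prems by auto
    have "u r \<noteq> Atom" using CondTrue by auto
    then show ?case
      by - (intro exI conjI, unfold simulate.simps, rule exec.CondTrue[OF _ 1(1)],
        use 1 K1[of 1] in \<open>auto simp: algebra_simps\<close>)
  next
    case (CondFalse s r d t s' c)
    obtain t1 u1 where 1: "exec orc (simulate m sub d) u t1 u1" "t1 \<le> K * t"
        "\<forall>r<m. u1 r = s' r" "u1 m = ctx"
      using CondFalse.IH[of u] CondFalse.prems by auto
    have "u r = Atom" using CondFalse by auto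
    then show ?case
      by - (intro exI conjI, unfold simulate.simps, rule exec.CondFalse[OF _ 1(1)],
        use 1 K1[of 1] in \<open>auto simp: algebra_simps\<close>)
  next
    case (WhileFalse s r c)
    then have "u r = Atom" by auto
    then show ?case
      by - (intro exI conjI, unfold simulate.simps, rule exec.WhileFalse,
        use WhileFalse K1[of 1] in auto)
  next
    case (WhileTrue s r c t s' w s'')
    obtain t1 u1 where 1: "exec orc (simulate m sub c) u t1 u1" "t1 \<le> K * t"
        "\<forall>r<m. u1 r = s' r" "u1 m = ctx"
      using WhileTrue.IH(1)[of u] WhileTrue.prems by auto
    obtain t2 u2 where 2: "exec orc (simulate m sub (While r c)) u1 t2 u2" "t2 \<le> K * w"
        "\<forall>r<m. u2 r = s'' r" "u2 m = ctx"
      using WhileTrue.IH(2)[of u1] WhileTrue.prems 1 by auto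
    have "u r \<noteq> Atom" using WhileTrue by auto
    then show ?case
      by - (intro exI conjI, unfold simulate.simps,
        rule exec.WhileTrue[OF _ 1(1) 2(1)[unfolded simulate.simps]],
        use 1 2 K1[of 1] in \<open>auto simp: algebra_simps\<close>)
  qed
qed

lemma implements_at_mono:
  assumes "implements_at b c g p" "\<And>n. poly p n \<le> poly q n"
  shows "implements_at b c g q"
  using assms unfolding implements_at_def by (meson order_trans)

text \<open>The general form of an oracle reduction: \<open>pre\<close> builds the instance for
  \<open>A\<close>, \<open>ctx\<close> keeps what is needed to answer queries and to decode, and
  \<open>post\<close> decodes. The bound is in terms of the actual time \<open>t\<close>, because
  \<open>A\<close> is known to halt quickly only on particular instances.\<close>

lemma polytime_reduction:
  fixes A :: "'q com" and pre post :: "('p \<Rightarrow> sexp \<Rightarrow> bool) \<Rightarrow> sexp \<Rightarrow> sexp"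
  assumes fin: "finite (UNIV :: 'q set)"
    and ctx: "polytime_fun ctx" and pre: "polytime_fun pre"
    and sub: "\<And>q. polytime_fun (sub q)" and post: "polytime_fun post"
  shows "\<exists>(A' :: 'p com) p. \<forall>orc orc' x t y.
     (\<forall>q z. sub q orc (Dot (ctx orc x) z) = sexp_of_bool (orc' q z)) \<longrightarrow>
     computes orc' A (pre orc x) t y \<longrightarrow>
     (\<exists>t'. computes orc A' x t' (post orc (Dot (ctx orc x) y)) \<and> t' \<le> poly p (sexp_size x + t))"
proof -
  \<comment> \<open>The successor keeps \<open>m\<close> apart from register 0, the input and output
    register, even if \<open>A\<close> mentions no register.\<close>
  define m where "m = Suc (reg_bound A)"
  let ?init = "\<lambda>orc x. Dot (ctx orc x) (pre orc x)"
  have init: "polytime_fun ?init" by (intro polytime_fun_Dot ctx pre)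
  obtain pi ci where ci: "implements_at m ci ?init pi"
    using init unfolding polytime_fun_def by blast
  obtain zi where zi: "\<And>orc x. sexp_size (?init orc x) \<le> poly zi (sexp_size x)"
    using polytime_fun_size[OF init] by blast
  obtain po co where co: "implements_at m co post po"
    using post unfolding polytime_fun_def by blast
  obtain zo where zo: "\<And>orc x. sexp_size (post orc x) \<le> poly zo (sexp_size x)"
    using polytime_fun_size[OF post] by blast
  have "\<forall>q. \<exists>p c. implements_at (m + 1) c (sub q) p"
    using sub unfolding polytime_fun_def by blast
  then obtain ps cs where cs: "\<And>q. implements_at (m + 1) (cs q) (sub q) (ps q)" by metis
  \<comment> \<open>With finitely many kinds of queries, the sum of the individual bounds serves for
    all of them.\<close>
  define P where "P = (\<Sum>q\<in>UNIV. ps q)"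
  have "implements_at (m + 1) (cs q) (sub q) P" for q
    using cs by (rule implements_at_mono)
      (use fin in \<open>auto simp: P_def poly_sum intro!: member_le_sum[of q UNIV "\<lambda>q. poly (ps q) _"]\<close>)
  note cs = this
  let ?A = "Seq (Copy m 0) (Seq ci (Seq (Cdr 0 m) (Seq (Car m m) (Seq (simulate m cs A)
    (Seq (MkDot m m 0) (Seq co (Copy 0 m)))))))"
  \<comment> \<open>Bounds the initial tree and also the output of \<open>A\<close>, which by
    \<open>exec_size\<close> is either its untouched input or of size at most
    \<open>t + 1\<close>.\<close>
  define Z where "Z = (\<lambda>n. poly zi n + n + 1)"
  define F where "F = (\<lambda>n. 15 + n + poly pi n + 4 * Z n + (9 + Z n + poly P (1 + Z n + n)) * n +
      poly po (1 + 2 * Z n) + poly zo (1 + 2 * Z n))"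
  have "poly_bounded F" unfolding F_def Z_def by (intro poly_bounded_intros)
  then obtain p where p: "\<And>n. F n \<le> poly p n" unfolding poly_bounded_def by blast
  show ?thesis
  proof (intro exI[of _ ?A] exI[of _ p] allI impI)
    fix orc :: "'p \<Rightarrow> sexp \<Rightarrow> bool" and orc' :: "'q \<Rightarrow> sexp \<Rightarrow> bool" and x t y
    assume orc': "\<forall>q z. sub q orc (Dot (ctx orc x) z) = sexp_of_bool (orc' q z)"
    assume "computes orc' A (pre orc x) t y"
    then obtain s' where s': "exec orc' A ((\<lambda>_. Atom)(0 := pre orc x)) t s'" "s' 0 = y"
      by (auto simp: computes_def)
    let ?n = "sexp_size x + t"
    define s0 :: state where "s0 = (\<lambda>_. Atom)(0 := x)"
    define s1 where "s1 = s0(m := s0 0)"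
    have m: "m \<noteq> 0" "0 < m" by (simp_all add: m_def)
    obtain t2 s2 where 2: "exec orc ci s1 t2 s2" "t2 \<le> poly pi (sexp_size (s1 m))"
        "s2 m = ?init orc (s1 m)" "\<And>r. r < m \<Longrightarrow> s2 r = s1 r"
      using implements_atE[OF ci, where orc = orc and s = s1] by blast
    have s1: "s1 m = x" by (simp add: s1_def s0_def)
    have s2: "s2 m = ?init orc x" using 2(3) s1 by simp
    define s3 where "s3 = s2(0 := cdr (s2 m))"
    define s4 where "s4 = s3(m := car (s3 m))"
    have s3: "s3 m = ?init orc x" using s2 m by (simp add: s3_def)
    have s4: "s4 m = ctx orc x" using s3 by (simp add: s4_def)
    \<comment> \<open>\<open>A\<close> must start with all registers except 0 empty. The preparatory
      code is based at \<open>m\<close> and has left the lower ones alone.\<close>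
    have s4': "\<forall>r<m. s4 r = ((\<lambda>_. Atom)(0 := pre orc x)) r"
      using s2 2(4) m by (auto simp: s4_def s3_def s1_def s0_def)
    let ?K = "9 + sexp_size (ctx orc x) + poly P (1 + sexp_size (ctx orc x) + t)"
    obtain t5 s5 where 5: "exec orc (simulate m cs A) s4 t5 s5" "t5 \<le> ?K * t"
        "\<forall>r<m. s5 r = s' r" "s5 m = ctx orc x"
      using exec_simulate[OF s'(1) _ cs orc'[rule_format] order_refl order_refl s4' s4]
      by (auto simp: m_def)
    have s5: "s5 0 = y" using 5(3) s'(2) m by simp
    define s6 where "s6 = s5(m := Dot (s5 m) (s5 0))"
    have s6: "s6 m = Dot (ctx orc x) y" using 5(4) s5 by (simp add: s6_def)
    obtain t7 s7 where 7: "exec orc co s6 t7 s7" "t7 \<le> poly po (sexp_size (s6 m))"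
        "s7 m = post orc (s6 m)" "\<And>r. r < m \<Longrightarrow> s7 r = s6 r"
      using implements_atE[OF co, where orc = orc and s = s6] by blast
    have s7: "s7 m = post orc (Dot (ctx orc x) y)" using 7(3) s6 by simp
    note e = exec.Seq[OF exec.Copy[of orc m 0 s0, folded s1_def] exec.Seq[OF 2(1)
        exec.Seq[OF exec.Cdr[of orc 0 m s2, folded s3_def] exec.Seq[OF exec.Car[of orc m m s3, folded s4_def]
        exec.Seq[OF 5(1) exec.Seq[OF exec.MkDot[of orc m m 0 s5, folded s6_def] exec.Seq[OF 7(1)
        exec.Copy[of orc 0 m s7]]]]]]]]
    have "sexp_size (?init orc x) \<le> poly zi ?n"
      using zi[of orc x] poly_nat_mono[of "sexp_size x" ?n zi] by simp
    then have Z: "sexp_size (?init orc x) \<le> Z ?n" by (simp add: Z_def)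
    then have Zc: "sexp_size (ctx orc x) \<le> Z ?n" by simp
    have Zy: "sexp_size y \<le> Z ?n"
      using exec_size[OF s'(1), of 0] s'(2) Z by (auto simp: Z_def)
    have D: "sexp_size (Dot (ctx orc x) y) \<le> 1 + 2 * Z ?n" using Zc Zy by simp
    have t2: "t2 \<le> poly pi ?n"
      using 2(2) poly_nat_mono[of "sexp_size x" ?n pi] s1 by simp
    have "?K * t \<le> (9 + Z ?n + poly P (1 + Z ?n + ?n)) * ?n"
      using Zc by (intro mult_le_mono add_mono poly_nat_mono) auto
    then have t5: "t5 \<le> (9 + Z ?n + poly P (1 + Z ?n + ?n)) * ?n" using 5(2) by simp
    have t7: "t7 \<le> poly po (1 + 2 * Z ?n)"
      using 7(2) poly_nat_mono[OF D, of po] s6 by simp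
    have out: "sexp_size (s7 m) \<le> poly zo (1 + 2 * Z ?n)"
      using zo[of orc "Dot (ctx orc x) y"] poly_nat_mono[OF D, of zo] s7 by simp
    have "1 + (1 + sexp_size (s0 0)) + (1 + t2 + (1 + (1 + sexp_size (s2 m)) + (1 + (1 + sexp_size (s3 m)) +
        (1 + t5 + (1 + (1 + sexp_size (s5 m) + sexp_size (s5 0)) + (1 + t7 + (1 + sexp_size (s7 m)))))))) \<le> F ?n"
      unfolding F_def s2 s3 5(4) s5 using Z Zc Zy t2 t5 t7 out by (simp add: s0_def)
    then have "1 + (1 + sexp_size (s0 0)) + (1 + t2 + (1 + (1 + sexp_size (s2 m)) + (1 + (1 + sexp_size (s3 m)) +
        (1 + t5 + (1 + (1 + sexp_size (s5 m) + sexp_size (s5 0)) + (1 + t7 + (1 + sexp_size (s7 m)))))))) \<le> poly p ?n"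
      using p order_trans by blast
    moreover have "(s7(0 := s7 m)) 0 = post orc (Dot (ctx orc x) y)" using s7 by simp
    ultimately show "\<exists>t'. computes orc ?A x t' (post orc (Dot (ctx orc x) y)) \<and> t' \<le> poly p ?n"
      unfolding computes_def s0_def[symmetric] using e by blast
  qed
qed

section \<open>The reduction to copies\<close>

text \<open>An index set of \<open>c * n ^ d\<close> trees: \<open>c\<close> unary numerals,
  multiplied \<open>d\<close> times by the list of the ground set. Both \<open>c\<close> and
  \<open>d\<close> are constants of the program, so this is a fixed number of products.\<close>

primrec tags :: "nat \<Rightarrow> nat \<Rightarrow> sexp \<Rightarrow> sexp" where
  "tags c 0 l = sexp_of_list (map (\<lambda>j. sexp_of_list (replicate j Atom)) [0..<c])"
| "tags c (Suc d) l = sexp_prod (tags c d l) l"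

lemma distinct_tags: "distinct (sexp_entries l) \<Longrightarrow> distinct (sexp_entries (tags c d l))"
proof (induction d)
  case 0
  have "inj (\<lambda>j. sexp_of_list (replicate j Atom))"
    by (rule injI) (metis length_replicate sexp_entries_of_list)
  then show ?case by (simp add: distinct_map inj_on_def)
qed (simp add: distinct_sexp_prod)

lemma card_tags:
  "distinct (sexp_entries l) \<Longrightarrow> card (sexp_set (tags c d l)) = c * card (sexp_set l) ^ d"
proof (induction d)
  case 0
  then show ?case
    using distinct_card[OF distinct_tags[OF 0, of c 0]] by simp
qed (simp add: card_copies)

lemma polytime_fun_tags: "polytime_fun l \<Longrightarrow> polytime_fun (\<lambda>orc x. tags c d (l orc x))"
  by (induction d) (auto intro: polytime_fun_const polytime_fun_prod)

text \<open>Since \<open>car\<close> and \<open>cdr\<close> fix \<open>Atom\<close>, the first test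
  prevents an untagged entry \<open>Atom\<close> from passing as the element \<open>Atom\<close>
  tagged \<open>Atom\<close>.\<close>

definition sexp_slice :: "sexp \<Rightarrow> sexp \<Rightarrow> sexp" where
  "sexp_slice t y = sexp_collect (\<lambda>e. \<not> e = Atom \<and> car e = t) cdr y"

lemma sexp_set_slice [simp]: "sexp_set (sexp_slice t y) = slice t (sexp_set y)"
proof -
  have "x \<in> cdr ` {e \<in> sexp_set y. e \<noteq> Atom \<and> car e = t} \<longleftrightarrow> Dot t x \<in> sexp_set y" for x
  proof
    assume "x \<in> cdr ` {e \<in> sexp_set y. e \<noteq> Atom \<and> car e = t}"
    then obtain e where "e \<in> sexp_set y" "e \<noteq> Atom" "car e = t" "x = cdr e" by auto
    then show "Dot t x \<in> sexp_set y" by (cases e) auto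
  qed (auto intro: rev_image_eqI[of "Dot t x"])
  then show ?thesis by (auto simp: sexp_slice_def slice_def)
qed

lemma polytime_fun_slice:
  assumes "polytime_fun t" "polytime_fun y"
  shows "polytime_fun (\<lambda>orc x. sexp_slice (t orc x) (y orc x))"
  unfolding sexp_slice_def
  by (intro polytime_fun_collect assms polytime_fun_conj polytime_fun_not polytime_fun_eq
      polytime_fun_cdr polytime_fun_car polytime_fun_id polytime_fun_Atom
      polytime_fun_comp[OF polytime_fun_car[OF polytime_fun_id] assms(1)])

text \<open>Stated for an arbitrary oracle, as \<open>polytime_fun\<close> quantifies over all of
  them; with independence oracles it decides independence in the union, at the cost of one query per
  tag.\<close>

definition copies_query :: "'q \<Rightarrow> ('q \<Rightarrow> sexp \<Rightarrow> bool) \<Rightarrow> sexp \<Rightarrow> sexp \<Rightarrow> bool" where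
  "copies_query q orc ts y \<longleftrightarrow> (\<forall>e\<in>sexp_set y. \<not> e = Atom \<and> car e \<in> sexp_set ts) \<and>
     (\<forall>t\<in>sexp_set ts. orc q (sexp_slice t y))"

lemma subset_copies_UNIV_iff: "X \<subseteq> copies T UNIV \<longleftrightarrow> (\<forall>e\<in>X. e \<noteq> Atom \<and> car e \<in> T)"
proof -
  have "e \<in> copies T UNIV \<longleftrightarrow> e \<noteq> Atom \<and> car e \<in> T" for e
    by (cases e) (auto simp: copies_def)
  then show ?thesis by blast
qed

lemma copies_query_independence_oracle:
  "copies_query q (independence_oracle \<I>\<^sub>0 \<I>\<^sub>1 \<I>\<^sub>2) ts y \<longleftrightarrow>
     independence_oracle (copies_indep (sexp_set ts) \<I>\<^sub>0) (copies_indep (sexp_set ts) \<I>\<^sub>1)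
       (copies_indep (sexp_set ts) \<I>\<^sub>2) q y"
  by (cases q) (simp_all add: copies_query_def copies_indep_def subset_copies_UNIV_iff)

lemma polytime_fun_copies_query:
  assumes "polytime_fun ts" "polytime_fun y"
  shows "polytime_fun (\<lambda>orc x. sexp_of_bool (copies_query q orc (ts orc x) (y orc x)))"
  unfolding copies_query_def
  by (intro polytime_fun_conj polytime_fun_ball assms polytime_fun_not polytime_fun_eq
      polytime_fun_member polytime_fun_query polytime_fun_slice
      polytime_fun_cdr polytime_fun_car polytime_fun_id polytime_fun_Atom
      polytime_fun_comp[OF polytime_fun_car[OF polytime_fun_id] assms(1)]
      polytime_fun_comp[OF polytime_fun_car[OF polytime_fun_id] assms(2)])

text \<open>Only \<open>M1\<close> and \<open>M2\<close> are asked, because slices of a basis of the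
  union are bases anyway. A slice may leave the smaller ground sets, so it is intersected with them
  before the query.\<close>

definition good_slice :: "(matroid_index \<Rightarrow> sexp \<Rightarrow> bool) \<Rightarrow> sexp \<Rightarrow> sexp \<Rightarrow> sexp \<Rightarrow> bool" where
  "good_slice orc l\<^sub>1 l\<^sub>2 z \<longleftrightarrow> orc M1 (sexp_collect (\<lambda>e. e \<in> sexp_set l\<^sub>1) (\<lambda>e. e) z) \<and>
     orc M2 (sexp_collect (\<lambda>e. e \<in> sexp_set l\<^sub>2) (\<lambda>e. e) z)"

lemma good_slice_iff:
  "good_slice (independence_oracle \<I>\<^sub>0 \<I>\<^sub>1 \<I>\<^sub>2) l\<^sub>1 l\<^sub>2 z \<longleftrightarrow>
     independent_in (sexp_set l\<^sub>1) \<I>\<^sub>1 (sexp_set z) \<and> independent_in (sexp_set l\<^sub>2) \<I>\<^sub>2 (sexp_set z)"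
  by (simp add: good_slice_def independent_in_def Int_def)

lemma polytime_fun_good_slice:
  assumes "polytime_fun l\<^sub>1" "polytime_fun l\<^sub>2" "polytime_fun z"
  shows "polytime_fun (\<lambda>orc x. sexp_of_bool (good_slice orc (l\<^sub>1 orc x) (l\<^sub>2 orc x) (z orc x)))"
  unfolding good_slice_def
  by (intro polytime_fun_conj polytime_fun_query polytime_fun_collect assms polytime_fun_member
      polytime_fun_cdr polytime_fun_id
      polytime_fun_comp[OF polytime_fun_car[OF polytime_fun_id] assms(1)]
      polytime_fun_comp[OF polytime_fun_car[OF polytime_fun_id] assms(2)])

theorem theorem5:
  fixes f :: "nat \<Rightarrow> real" and \<epsilon> :: real
  assumes "\<epsilon> > 0"
    and "f \<in> O(\<lambda>n. real n powr (1 - \<epsilon>))"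
    and "\<exists>A. polytime_finds A (\<lambda>N \<I>\<^sub>0 N\<^sub>1 \<I>\<^sub>1 N\<^sub>2 \<I>\<^sub>2 B.
           matroid_basis \<I>\<^sub>0 B \<and>
           additively_independent_in (f (card N)) N\<^sub>1 \<I>\<^sub>1 B \<and>
           additively_independent_in (f (card N)) N\<^sub>2 \<I>\<^sub>2 B)"
  shows "\<exists>A'. polytime_finds A' (\<lambda>N \<I>\<^sub>0 N\<^sub>1 \<I>\<^sub>1 N\<^sub>2 \<I>\<^sub>2 B.
           matroid_basis \<I>\<^sub>0 B \<and>
           independent_in N\<^sub>1 \<I>\<^sub>1 B \<and>
           independent_in N\<^sub>2 \<I>\<^sub>2 B)"
proof -
  obtain A where A: "polytime_finds A (\<lambda>N \<I>\<^sub>0 N\<^sub>1 \<I>\<^sub>1 N\<^sub>2 \<I>\<^sub>2 B. matroid_basis \<I>\<^sub>0 B \<and>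
      additively_independent_in (f (card N)) N\<^sub>1 \<I>\<^sub>1 B \<and>
      additively_independent_in (f (card N)) N\<^sub>2 \<I>\<^sub>2 B)"
    using assms(3) by blast
  then obtain pA where pA: "\<And>ns ns\<^sub>1 ns\<^sub>2 \<I>\<^sub>0 \<I>\<^sub>1 \<I>\<^sub>2.
      distinct ns \<Longrightarrow> distinct ns\<^sub>1 \<Longrightarrow> distinct ns\<^sub>2 \<Longrightarrow>
      feasible_instance (set ns) \<I>\<^sub>0 (set ns\<^sub>1) \<I>\<^sub>1 (set ns\<^sub>2) \<I>\<^sub>2 \<Longrightarrow>
      \<exists>t y. computes (independence_oracle \<I>\<^sub>0 \<I>\<^sub>1 \<I>\<^sub>2) A (ground_sets_input ns ns\<^sub>1 ns\<^sub>2) t y \<and>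
         t \<le> poly pA (sexp_size (ground_sets_input ns ns\<^sub>1 ns\<^sub>2)) \<and>
         matroid_basis \<I>\<^sub>0 (sexp_set y) \<and>
         additively_independent_in (f (card (set ns))) (set ns\<^sub>1) \<I>\<^sub>1 (sexp_set y) \<and>
         additively_independent_in (f (card (set ns))) (set ns\<^sub>2) \<I>\<^sub>2 (sexp_set y)"
    unfolding polytime_finds_def by metis
  obtain c d :: nat where cd: "\<And>n. 0 < n \<Longrightarrow> 2 * f (c * n ^ d * n) < real (c * n ^ d)" "0 < d"
    using enough_copies[OF assms(1,2)] by blast
  define ctx :: "(matroid_index \<Rightarrow> sexp \<Rightarrow> bool) \<Rightarrow> sexp \<Rightarrow> sexp"
    \<comment> \<open>The tags serve to answer queries and to enumerate the copies; the original
      input supplies the ground sets for the final selection.\<close>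
    where "ctx = (\<lambda>orc x. Dot (tags c d (car x)) x)"
  define pre :: "(matroid_index \<Rightarrow> sexp \<Rightarrow> bool) \<Rightarrow> sexp \<Rightarrow> sexp"
    where "pre = (\<lambda>orc x. Dot (sexp_prod (tags c d (car x)) (car x))
      (Dot (sexp_prod (tags c d (car x)) (car (cdr x))) (sexp_prod (tags c d (car x)) (cdr (cdr x)))))"
  define sub :: "matroid_index \<Rightarrow> (matroid_index \<Rightarrow> sexp \<Rightarrow> bool) \<Rightarrow> sexp \<Rightarrow> sexp"
    where "sub = (\<lambda>q orc z. sexp_of_bool (copies_query q orc (car (car z)) (cdr z)))"
  \<comment> \<open>Here \<open>z\<close> is \<open>Dot (Dot tags x) y\<close> with the output
    \<open>y\<close> of the simulated run; the two long paths lead to the lists of the second and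
    third ground set inside \<open>x\<close>.\<close>
  define post :: "(matroid_index \<Rightarrow> sexp \<Rightarrow> bool) \<Rightarrow> sexp \<Rightarrow> sexp"
    where "post = (\<lambda>orc z. fold (\<lambda>t acc. if good_slice orc (car (cdr (cdr (car z))))
        (cdr (cdr (cdr (car z)))) (sexp_slice t (cdr z)) then sexp_slice t (cdr z) else acc)
      (sexp_entries (car (car z))) Atom)"
  have pctx: "polytime_fun ctx" unfolding ctx_def
    by (intro polytime_fun_Dot polytime_fun_tags polytime_fun_car polytime_fun_id)
  have ppre: "polytime_fun pre" unfolding pre_def
    by (intro polytime_fun_Dot polytime_fun_prod polytime_fun_tags polytime_fun_car polytime_fun_cdr
        polytime_fun_id)
  have psub: "polytime_fun (sub q)" for q unfolding sub_def
    by (intro polytime_fun_copies_query polytime_fun_car polytime_fun_cdr polytime_fun_id)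
  have ppost: "polytime_fun post" unfolding post_def
    by (intro polytime_fun_select polytime_fun_good_slice polytime_fun_slice
        polytime_fun_car polytime_fun_cdr polytime_fun_id)
  have "(UNIV :: matroid_index set) \<subseteq> {M0, M1, M2}" using matroid_index.exhaust by blast
  then have "finite (UNIV :: matroid_index set)" by (rule finite_subset) simp
  from polytime_reduction[where A = A and sub = sub, OF this pctx ppre psub ppost]
  obtain A' p where A': "\<forall>orc orc' x t y.
      (\<forall>q z. sub q orc (Dot (ctx orc x) z) = sexp_of_bool (orc' q z)) \<longrightarrow>
      computes orc' A (pre orc x) t y \<longrightarrow>
      (\<exists>t'. computes orc A' x t' (post orc (Dot (ctx orc x) y)) \<and> t' \<le> poly p (sexp_size x + t))"
    by (elim exE)
  obtain zp where zp: "\<And>orc x. sexp_size (pre orc x) \<le> poly zp (sexp_size x)"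
    using polytime_fun_size[OF ppre] by blast
  \<comment> \<open>From the inside: the size of the copied instance, the time of \<open>A\<close>
    on it, and the time of the simulation.\<close>
  have "poly_bounded (\<lambda>n. poly p (n + poly pA (poly zp n)))" by (intro poly_bounded_intros)
  then obtain r where r: "\<And>n. poly p (n + poly pA (poly zp n)) \<le> poly r n"
    unfolding poly_bounded_def by blast
  have "\<exists>t y. computes (independence_oracle \<I>\<^sub>0 \<I>\<^sub>1 \<I>\<^sub>2) A' (ground_sets_input ns ns\<^sub>1 ns\<^sub>2) t y \<and>
      t \<le> poly r (sexp_size (ground_sets_input ns ns\<^sub>1 ns\<^sub>2)) \<and>
      matroid_basis \<I>\<^sub>0 (sexp_set y) \<and> independent_in (set ns\<^sub>1) \<I>\<^sub>1 (sexp_set y) \<and>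
      independent_in (set ns\<^sub>2) \<I>\<^sub>2 (sexp_set y)"
    if dist: "distinct ns" "distinct ns\<^sub>1" "distinct ns\<^sub>2"
      and feas: "feasible_instance (set ns) \<I>\<^sub>0 (set ns\<^sub>1) \<I>\<^sub>1 (set ns\<^sub>2) \<I>\<^sub>2"
    for ns ns\<^sub>1 ns\<^sub>2 \<I>\<^sub>0 \<I>\<^sub>1 \<I>\<^sub>2
  proof -
    let ?orc = "independence_oracle \<I>\<^sub>0 \<I>\<^sub>1 \<I>\<^sub>2"
    let ?x = "ground_sets_input ns ns\<^sub>1 ns\<^sub>2"
    let ?ts = "tags c d (sexp_of_list ns)"
    let ?T = "sexp_set ?ts"
    let ?C = "\<lambda>xs. sexp_entries (sexp_prod ?ts (sexp_of_list xs))"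
    let ?orc' = "independence_oracle (copies_indep ?T \<I>\<^sub>0) (copies_indep ?T \<I>\<^sub>1) (copies_indep ?T \<I>\<^sub>2)"
    have finT: "finite ?T" unfolding set_sexp_entries[symmetric] by (rule finite_set)
    have cardT: "card ?T = c * card (set ns) ^ d"
      using card_tags[of "sexp_of_list ns" c d] dist(1) by simp
    have distC: "distinct (?C xs)" if "distinct xs" for xs
      using that dist(1) by (intro distinct_sexp_prod distinct_tags) auto
    have setC: "set (?C xs) = copies ?T (set xs)" for xs
      by simp
    have pre: "pre ?orc ?x = ground_sets_input (?C ns) (?C ns\<^sub>1) (?C ns\<^sub>2)"
      by (simp add: pre_def ground_sets_input_def)
    obtain t y where y: "computes ?orc' A (pre ?orc ?x) t y"
        "t \<le> poly pA (sexp_size (pre ?orc ?x))"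
        "matroid_basis (copies_indep ?T \<I>\<^sub>0) (sexp_set y)"
        "additively_independent_in (f (card (copies ?T (set ns)))) (copies ?T (set ns\<^sub>1))
          (copies_indep ?T \<I>\<^sub>1) (sexp_set y)"
        "additively_independent_in (f (card (copies ?T (set ns)))) (copies ?T (set ns\<^sub>2))
          (copies_indep ?T \<I>\<^sub>2) (sexp_set y)"
      using pA[OF distC[OF dist(1)] distC[OF dist(2)] distC[OF dist(3)],
          unfolded setC, OF feasible_instance_copies[OF feas finT]]
      unfolding pre by blast
    have ctx: "ctx ?orc ?x = Dot ?ts ?x" by (simp add: ctx_def ground_sets_input_def)
    have "sub q ?orc (Dot (ctx ?orc ?x) z) = sexp_of_bool (?orc' q z)" for q z
      by (simp add: sub_def ctx copies_query_independence_oracle)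
    from A'[rule_format, OF this y(1)] obtain t'
      where t': "computes ?orc A' ?x t' (post ?orc (Dot (ctx ?orc ?x) y))" "t' \<le> poly p (sexp_size ?x + t)"
      by blast
    have "t \<le> poly pA (poly zp (sexp_size ?x))"
      using y(2) poly_nat_mono[OF zp] by (rule order_trans)
    then have "poly p (sexp_size ?x + t) \<le> poly p (sexp_size ?x + poly pA (poly zp (sexp_size ?x)))"
      by (intro poly_nat_mono) simp
    with t'(2) r[of "sexp_size ?x"] have time: "t' \<le> poly r (sexp_size ?x)" by linarith
    let ?good = "\<lambda>t. good_slice ?orc (sexp_of_list ns\<^sub>1) (sexp_of_list ns\<^sub>2) (sexp_slice t y)"
    have post: "post ?orc (Dot (ctx ?orc ?x) y) =
        fold (\<lambda>t acc. if ?good t then sexp_slice t y else acc) (sexp_entries ?ts) Atom"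
      unfolding ctx by (simp add: post_def ground_sets_input_def)
    have good: "?good t \<longleftrightarrow> independent_in (set ns\<^sub>1) \<I>\<^sub>1 (slice t (sexp_set y)) \<and>
        independent_in (set ns\<^sub>2) \<I>\<^sub>2 (slice t (sexp_set y))" for t
      by (simp add: good_slice_iff)
    have M: "matroid (set ns) \<I>\<^sub>0" "matroid (set ns\<^sub>1) \<I>\<^sub>1" "matroid (set ns\<^sub>2) \<I>\<^sub>2"
      using feas by (simp_all add: feasible_instance_def)
    have "matroid_basis \<I>\<^sub>0 (sexp_set (post ?orc (Dot (ctx ?orc ?x) y))) \<and>
        independent_in (set ns\<^sub>1) \<I>\<^sub>1 (sexp_set (post ?orc (Dot (ctx ?orc ?x) y))) \<and>
        independent_in (set ns\<^sub>2) \<I>\<^sub>2 (sexp_set (post ?orc (Dot (ctx ?orc ?x) y)))"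
    \<comment> \<open>The count of copies requires a nonempty ground set. For an empty one there are
      no tags, as \<open>d\<close> is positive, and the default \<open>Atom\<close> of the search
      stands for the empty set, which is then the only basis.\<close>
    proof (cases "ns = []")
      case True
      then have "?T = {}" using cardT cd(2) finT by (simp add: zero_power)
      then have "sexp_entries ?ts = []" by (metis set_empty set_sexp_entries)
      then have "sexp_set (post ?orc (Dot (ctx ?orc ?x) y)) = {}" unfolding post by simp
      moreover have "matroid_basis \<I>\<^sub>0 {}"
        using matroid.empty_indep[OF M(1)] matroid.indep_subset_ground[OF M(1)] True
        unfolding matroid_basis_def by auto
      ultimately show ?thesis
        using matroid.empty_indep[OF M(2)] matroid.empty_indep[OF M(3)]
        by (simp add: independent_in_def)
    next
      case False
      then have "0 < card (set ns)" by (simp add: card_gt_0_iff)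
      from cd(1)[OF this] have "2 * f (card (copies ?T (set ns))) < real (card ?T)"
        by (simp only: card_copies cardT)
      from exists_independent_slice[OF M(2,3) finT y(4,5) this]
      have "\<exists>t\<in>set (sexp_entries ?ts). ?good t" by (simp add: good)
      then obtain t where "t \<in> set (sexp_entries ?ts)" "?good t"
          "post ?orc (Dot (ctx ?orc ?x) y) = sexp_slice t y"
        unfolding post by (rule fold_select)
      then show ?thesis using good matroid_basis_slice[OF y(3), of t] by simp
    qed
    with t'(1) time show ?thesis by blast
  qed
  then show ?thesis
    unfolding polytime_finds_def by (intro exI[of _ A'] exI[of _ r]) simp
qed

end
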